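(* Let $K$ be an algebraically closed field of characteristic zero. Let $S\le\mathfrak I_n$ be an inverse subsemigroup, let $0\le p\le n$, and let $\theta^{\wedge p}$ denote the character of the $p$-th exterior power of the rook matrix representation of $S$ over $K$. Suppose that $S$ contains all the rank $p$ idempotents of $\mathfrak I_n$. Let $G_e$ be a maximal subgroup of $S$ (with identity $e\in E(S)$) and let $\chi\in\mathrm{Irr}(G_e)$. Then \[(\chi,\theta^{\wedge p})_S=\begin{cases}1 & \text{if } \mathrm{rk}(e)=p \text{ and } \chi=\mathrm{sgn}_e,\\ 0&\text{otherwise.}\end{cases}\] In particular, under these hypotheses $\theta^{\wedge p}$ is an irreducible character if and only if all rank $p$ idempotents of $S$ are isomorphic. So for $\mathfrak I_n$, all the exterior powers of the rook matrix representation are irreducible.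
   Context: $[n]=\{1,\dots,n\}$; $\mathfrak I_n$ is the monoid of all partial permutations of $[n]$ (bijections between subsets, including the empty one), acting on the right. An inverse subsemigroup is a subsemigroup closed under inverses. The rank $\mathrm{rk}(\sigma)$ is the cardinality of the range of $\sigma$. The idempotents of $\mathfrak I_n$ are the partial identities $1_Z$, $Z\subseteq[n]$. $E(S)$ is the set of idempotents of $S$, ordered by $1_Z\le1_{Z'}\iff Z\subseteq Z'$, with M\"obius function $\mu$. For $s\in S$, identify $\mathrm{dom}(s)$ with $ss^{-1}$ and $\mathrm{ran}(s)$ with $s^{-1}s$ (partial identities are identified with the corresponding subsets). Idempotents $e,f\in E(S)$ are isomorphic if some $s\in S$ has $ss^{-1}=e$ and $s^{-1}s=f$. The maximal subgroup at $e$ is $G_e=\{s\in S: ss^{-1}=e=s^{-1}s\}$, a permutation group on $\mathrm{dom}(e)$. $\mathrm{Irr}(G_e)$ is the set of irreducible characters of $G_e$ over $K$. The map $\mathrm{sgn}_e:G_e\to K$ sends $g$ to its sign as a permutation of $\mathrm{dom}(e)$: $1$ if $g$ is an even permutation of $\mathrm{dom}(e)$, $-1$ otherwise. The rook matrix representation of $S$ sends $\sigma$ to the $n\times n$ matrix with $(i,j)$ entry $1$ if $i\sigma=j$ and $0$ otherwise. For a character $\theta$ of $S$ over $K$ and $\chi\in \mathrm{Irr}(G_e)$, \[(\chi,\theta)_S=\sum_{f\in E(S),\,f\le e}\Big(\frac1{|G_e|}\sum_{g\in G_e}\chi(g^{-1})\theta(fg)\Big)\mu(f,e).\] *)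

theory Defs
  imports "Jordan_Normal_Form.VS_Connect" "HOL-Combinatorics.Permutations"
begin

section \<open>Partial permutations\<close>

text \<open>
  A partial permutation is represented by its graph, so \<open>i \<sigma> = j\<close> reads \<open>(i, j) \<in> \<sigma>\<close>. Since partial
  permutations act on the right, the product \<open>\<sigma> \<tau>\<close> is the relational composition \<open>\<sigma> O \<tau>\<close>;
  the inverse is \<open>\<sigma>\<inverse>\<close>, the partial identity on \<open>Z\<close> is \<open>Id_on Z\<close>, and the order
  of partial identities (\<open>Z \<subseteq> Z'\<close>) is inclusion of graphs.
\<close>

type_synonym pperm = "(nat \<times> nat) set"

definition partial_perms :: "nat \<Rightarrow> pperm set" where
  "partial_perms n = {\<sigma>. \<sigma> \<subseteq> {1..n} \<times> {1..n} \<and> single_valued \<sigma> \<and> single_valued (\<sigma>\<inverse>)}"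

definition inverse_subsemigroup :: "nat \<Rightarrow> pperm set \<Rightarrow> bool" where
  "inverse_subsemigroup n S \<longleftrightarrow>
     S \<subseteq> partial_perms n \<and> (\<forall>s\<in>S. \<forall>t\<in>S. s O t \<in> S) \<and> (\<forall>s\<in>S. s\<inverse> \<in> S)"

definition rk :: "pperm \<Rightarrow> nat" where
  "rk \<sigma> = card (Range \<sigma>)"

definition idempotents :: "pperm set \<Rightarrow> pperm set" where
  "idempotents S = {e \<in> S. e O e = e}"

definition isomorphic_idempotents :: "pperm set \<Rightarrow> pperm \<Rightarrow> pperm \<Rightarrow> bool" where
  "isomorphic_idempotents S e f \<longleftrightarrow> (\<exists>s\<in>S. s O s\<inverse> = e \<and> s\<inverse> O s = f)"

definition maximal_subgroup :: "pperm set \<Rightarrow> pperm \<Rightarrow> pperm set" where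
  "maximal_subgroup S e = {s \<in> S. s O s\<inverse> = e \<and> s\<inverse> O s = e}"

text \<open>
  For \<open>g\<close> in the maximal subgroup at \<open>e\<close>, the map \<open>\<lambda>i. THE j. (i, j) \<in> g\<close> permutes \<open>Domain e\<close>; its
  values outside \<open>Domain e\<close> are disregarded by \<^const>\<open>sign_on\<close>.
\<close>

definition sgn_at :: "pperm \<Rightarrow> pperm \<Rightarrow> 'a::ring_1" where
  "sgn_at e g = of_int (sign_on (Domain e) (\<lambda>i. THE j. (i, j) \<in> g))"


section \<open>The Moebius function of a finite poset\<close>

function moebius :: "'b::order set \<Rightarrow> 'b \<Rightarrow> 'b \<Rightarrow> int" where
  "moebius P x y =
     (if x = y then 1
      else if finite P \<and> x < y then - (\<Sum>z\<in>{z \<in> P. x \<le> z \<and> z < y}. moebius P x z)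
      else 0)"
  by pat_completeness auto
termination
proof (relation "measure (\<lambda>(P, x, y). card {z \<in> P. z < y})", goal_cases)
  case 1
  then show ?case by simp
next
  case (2 P x y z)
  then have "{w \<in> P. w < z} \<subset> {w \<in> P. w < y}" by auto
  then show ?case using 2 by (simp add: psubset_card_mono)
qed

declare moebius.simps [simp del]


section \<open>Matrix representations and characters\<close>

text \<open>
  The following notions are used both for a semigroup \<open>S\<close> of partial permutations and for its
  maximal subgroups. Matrices act on column vectors; invariant subspaces of columns and of rows are
  exchanged by taking annihilators, so irreducibility does not depend on this choice. An irreducible
  representation is required not to be the null representation; for a group this amounts to sending
  the identity to the identity matrix.
\<close>

definition representation :: "pperm set \<Rightarrow> nat \<Rightarrow> (pperm \<Rightarrow> 'a::field mat) \<Rightarrow> bool" where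
  "representation S d \<rho> \<longleftrightarrow>
     (\<forall>s\<in>S. \<rho> s \<in> carrier_mat d d) \<and> (\<forall>s\<in>S. \<forall>t\<in>S. \<rho> (s O t) = \<rho> s * \<rho> t)"

definition irreducible_rep :: "pperm set \<Rightarrow> nat \<Rightarrow> (pperm \<Rightarrow> 'a::field mat) \<Rightarrow> bool" where
  "irreducible_rep S d \<rho> \<longleftrightarrow>
     representation S d \<rho> \<and> (\<exists>s\<in>S. \<rho> s \<noteq> 0\<^sub>m d d) \<and>
     (\<forall>W. subspace class_ring W (module_vec TYPE('a) d) \<and> (\<forall>s\<in>S. \<forall>v\<in>W. \<rho> s *\<^sub>v v \<in> W)
        \<longrightarrow> W = {0\<^sub>v d} \<or> W = carrier_vec d)"

definition character :: "(pperm \<Rightarrow> 'a::field mat) \<Rightarrow> pperm \<Rightarrow> 'a" where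
  "character \<rho> s = (\<Sum>i<dim_row (\<rho> s). \<rho> s $$ (i, i))"

text \<open>Only the values of a character on \<open>S\<close> matter; its values elsewhere are arbitrary.\<close>

definition Irr :: "pperm set \<Rightarrow> (pperm \<Rightarrow> 'a::field) set" where
  "Irr S = {\<chi>. \<exists>d \<rho>. irreducible_rep S d \<rho> \<and> (\<forall>s\<in>S. \<chi> s = character \<rho> s)}"

definition char_prod :: "pperm set \<Rightarrow> pperm \<Rightarrow> (pperm \<Rightarrow> 'a::field) \<Rightarrow> (pperm \<Rightarrow> 'a) \<Rightarrow> 'a" where
  "char_prod S e \<chi> \<theta> =
     (\<Sum>f\<in>{f \<in> idempotents S. f \<subseteq> e}.
        (1 / of_nat (card (maximal_subgroup S e)) *
          (\<Sum>g\<in>maximal_subgroup S e. \<chi> (g\<inverse>) * \<theta> (f O g))) *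
        of_int (moebius (idempotents S) f e))"

text \<open>Matrix indices start at 0, whereas partial permutations act on \<open>{1..n}\<close>.\<close>

definition rook_mat :: "nat \<Rightarrow> pperm \<Rightarrow> 'a::field mat" where
  "rook_mat n \<sigma> = mat n n (\<lambda>(i, j). if (Suc i, Suc j) \<in> \<sigma> then 1 else 0)"


section \<open>Exterior powers\<close>

text \<open>
  The exterior power is specified by its universal property. A \<open>p\<close>-tuple of vectors of \<open>K\<^sup>n\<close> is a list
  of length \<open>p\<close>.
\<close>

definition vec_tuples :: "nat \<Rightarrow> nat \<Rightarrow> 'a vec list set" where
  "vec_tuples n p = {vs. length vs = p \<and> set vs \<subseteq> carrier_vec n}"

definition alternating_map :: "nat \<Rightarrow> nat \<Rightarrow> nat \<Rightarrow> ('a::field vec list \<Rightarrow> 'a vec) \<Rightarrow> bool" where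
  "alternating_map n p m f \<longleftrightarrow>
     (\<forall>vs\<in>vec_tuples n p.
        f vs \<in> carrier_vec m \<and>
        (\<forall>i<p. \<forall>u\<in>carrier_vec n. \<forall>v\<in>carrier_vec n.
           f (vs[i := u + v]) = f (vs[i := u]) + f (vs[i := v])) \<and>
        (\<forall>i<p. \<forall>c. \<forall>u\<in>carrier_vec n. f (vs[i := c \<cdot>\<^sub>v u]) = c \<cdot>\<^sub>v f (vs[i := u])) \<and>
        (\<forall>i<p. \<forall>j<p. i \<noteq> j \<and> vs ! i = vs ! j \<longrightarrow> f vs = 0\<^sub>v m))"

text \<open>
  \<open>K\<^sup>d\<close> together with \<open>w [v\<^sub>1, \<dots>, v\<^sub>p] = v\<^sub>1 \<and> \<dots> \<and> v\<^sub>p\<close> is a \<open>p\<close>-th exterior power of \<open>K\<^sup>n\<close>: every alternating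
  map on \<open>p\<close>-tuples factors uniquely through \<open>w\<close> by a linear map.
\<close>

definition is_exterior_power :: "nat \<Rightarrow> nat \<Rightarrow> nat \<Rightarrow> ('a::field vec list \<Rightarrow> 'a vec) \<Rightarrow> bool" where
  "is_exterior_power n p d w \<longleftrightarrow>
     alternating_map n p d w \<and>
     (\<forall>m f. alternating_map n p m f \<longrightarrow>
        (\<exists>!B. B \<in> carrier_mat m d \<and> (\<forall>vs\<in>vec_tuples n p. f vs = B *\<^sub>v w vs)))"

text \<open>
  \<open>\<rho>\<close> is, in some basis of the exterior power, the \<open>p\<close>-th exterior power of the degree \<open>n\<close> matrix
  representation \<open>R\<close>; so \<open>\<rho>\<close> is determined by \<open>R\<close> and \<open>p\<close> up to similarity, and \<open>character \<rho>\<close> is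
  determined on \<open>S\<close>.
\<close>

definition exterior_power_rep ::
  "pperm set \<Rightarrow> nat \<Rightarrow> (pperm \<Rightarrow> 'a::field mat) \<Rightarrow> nat \<Rightarrow> nat \<Rightarrow> (pperm \<Rightarrow> 'a mat) \<Rightarrow> bool" where
  "exterior_power_rep S n R p d \<rho> \<longleftrightarrow>
     (\<exists>w. is_exterior_power n p d w \<and>
        (\<forall>s\<in>S. \<rho> s \<in> carrier_mat d d \<and>
           (\<forall>vs\<in>vec_tuples n p. \<rho> s *\<^sub>v w vs = w (map (\<lambda>v. R s *\<^sub>v v) vs))))"

end

theory Submission
  imports Defs
begin

text \<open>
  Let \<open>\<theta>\<close> be the character of the \<open>p\<close>-th exterior power. With respect to the basis of the wedge products of
  standard basis vectors, \<open>\<theta>(s)\<close> is the sum of the principal \<open>p \<times> p\<close> minors of the rook matrix of \<open>s\<close>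
  (\<open>character_rook_exterior_power\<close>). These minors behave well under restriction: the minor of \<open>f g\<close> with
  support \<open>X\<close>, for an idempotent \<open>f\<close>, is that of \<open>g\<close> if \<open>1\<^sub>X \<le> f\<close> and is \<open>0\<close> otherwise. Since every \<open>1\<^sub>X\<close> with
  \<open>X\<close> of size \<open>p\<close> lies in \<open>S\<close>, Moebius inversion over the idempotents below \<open>e\<close> gives, for \<open>g\<close> in the maximal
  subgroup at \<open>e\<close>, that \<open>\<Sum>f\<le>e. \<mu>(f, e) \<theta>(f g)\<close> is the sign of \<open>g\<close> if \<open>e\<close> has rank \<open>p\<close>, and \<open>0\<close> otherwise
  (\<open>moebius_sum_exterior_character\<close>). So \<open>(\<chi>, \<theta>)\<close> is \<open>0\<close> or the inner product of \<open>\<chi>\<close> with the sign character of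
  the maximal subgroup, and \<open>linear_character_orthogonality\<close> finishes the computation.

  For the criterion of irreducibility, suppose first that all idempotents of rank \<open>p\<close> are isomorphic.
  These idempotents act on the exterior power as projections to the lines spanned by the basis elements,
  and \<open>S\<close> moves any of these lines to any other; hence the representation is irreducible
  (\<open>exterior_power_irreducible\<close>). For the symmetric inverse monoid, two idempotents of the same rank are always
  isomorphic.

  Conversely, let \<open>\<theta>\<close> be the character of an irreducible representation, and let \<open>e\<close> and \<open>e'\<close> be of rank \<open>p\<close>.
  The elements \<open>\<epsilon>\<^sub>e = \<Sum>f\<le>e. \<mu>(f, e) f\<close> and \<open>\<epsilon>\<^sub>e\<^sub>'\<close> of the semigroup algebra act with trace \<open>1\<close>, by the formula
  above at \<open>g = e\<close>. By Weisner's theorem, \<open>\<epsilon>\<^sub>e s \<epsilon>\<^sub>e\<^sub>' = 0\<close> for all \<open>s\<close> in \<open>S\<close> if \<open>e\<close> and \<open>e'\<close> are not isomorphic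
  (\<open>moebius_sums_separate\<close>). In that case the vectors \<open>v\<close> with \<open>\<epsilon>\<^sub>e s v = 0\<close> for all \<open>s\<close> form an invariant subspace
  that is neither zero nor everything, a contradiction (\<open>isomorphic_if_irreducible\<close>).
\<close>

section \<open>Moebius functions and meet semilattices\<close>

lemma moebius_self [simp]: "moebius P x x = 1"
  by (subst moebius.simps) simp

lemma sum_moebius_upper:
  assumes "finite P" "x \<in> P" "y \<in> P" "x \<le> y"
  shows "(\<Sum>z\<in>{z \<in> P. x \<le> z \<and> z \<le> y}. moebius P x z) = (if x = y then 1 else 0)"
proof (cases "x = y")
  case True
  then have "{z \<in> P. x \<le> z \<and> z \<le> y} = {x}" using assms by auto
  with True show ?thesis by simp
next
  case False
  then have "x < y" using assms by simp
  have "{z \<in> P. x \<le> z \<and> z \<le> y} = insert y {z \<in> P. x \<le> z \<and> z < y}"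
    using assms by (auto simp: le_less)
  moreover have "moebius P x y = - (\<Sum>z\<in>{z \<in> P. x \<le> z \<and> z < y}. moebius P x z)"
    using \<open>x < y\<close> \<open>finite P\<close> by (subst moebius.simps) simp
  ultimately show ?thesis using False \<open>finite P\<close> by simp
qed

text \<open>
  The recursion for \<^const>\<open>moebius\<close> says that \<open>\<mu>\<close> is a one-sided inverse of the zeta function in the
  incidence algebra; this lemma says that it is an inverse on the other side. With \<open>g\<close> the left-hand
  side, associativity \<open>(\<zeta>\<mu>)\<zeta> = \<zeta>(\<mu>\<zeta>)\<close> yields that the sum of \<open>g\<close> over each interval is \<open>1\<close>, and this
  determines \<open>g\<close> from the bottom of the interval upwards.
\<close>

lemma sum_moebius_lower:
  assumes "finite P" "x \<in> P" "y \<in> P" "x \<le> y"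
  shows "(\<Sum>z\<in>{z \<in> P. x \<le> z \<and> z \<le> y}. moebius P z y) = (if x = y then 1 else 0)"
  using assms(3,4)
proof (induction "card {z \<in> P. z < y}" arbitrary: y rule: less_induct)
  case less
  define g where "g y = (\<Sum>z\<in>{z \<in> P. x \<le> z \<and> z \<le> y}. moebius P z y)" for y
  have IH: "g z = (if x = z then 1 else 0)" if "z \<in> P" "x \<le> z" "z < y" for z
  proof -
    have "{w \<in> P. w < z} \<subset> {w \<in> P. w < y}" using that by auto
    then have "card {w \<in> P. w < z} < card {w \<in> P. w < y}"
      by (intro psubset_card_mono) (use assms in auto)
    from less.hyps[OF this] that show ?thesis unfolding g_def by simp
  qed
  let ?I = "{z \<in> P. x \<le> z \<and> z \<le> y}"
  have fin: "finite ?I" using assms by simp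
  have "(\<Sum>z\<in>?I. g z) = (\<Sum>z\<in>?I. \<Sum>w\<in>{w \<in> ?I. w \<le> z}. moebius P w z)"
    unfolding g_def by (intro sum.cong refl) auto
  also have "\<dots> = (\<Sum>w\<in>?I. \<Sum>z\<in>{z \<in> ?I. w \<le> z}. moebius P w z)"
    by (rule sum.swap_restrict) (use fin in auto)
  also have "\<dots> = (\<Sum>w\<in>?I. if w = y then 1 else 0)"
  proof (intro sum.cong refl)
    fix w assume w: "w \<in> ?I"
    then have "{z \<in> ?I. w \<le> z} = {z \<in> P. w \<le> z \<and> z \<le> y}" by auto
    then show "(\<Sum>z\<in>{z \<in> ?I. w \<le> z}. moebius P w z) = (if w = y then 1 else 0)"
      using sum_moebius_upper[of P w y] w less.prems assms(1) by simp
  qed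
  also have "\<dots> = 1" using fin less.prems by simp
  finally have *: "(\<Sum>z\<in>?I. g z) = 1" .
  have "?I = insert y {z \<in> P. x \<le> z \<and> z < y}" using less.prems by (auto simp: le_less)
  then have "(\<Sum>z\<in>?I. g z) = g y + (\<Sum>z\<in>{z \<in> P. x \<le> z \<and> z < y}. g z)"
    using assms(1) by simp
  also have "(\<Sum>z\<in>{z \<in> P. x \<le> z \<and> z < y}. g z)
      = (\<Sum>z\<in>{z \<in> P. x \<le> z \<and> z < y}. if x = z then 1 else 0)"
    by (intro sum.cong refl) (use IH in auto)
  also have "\<dots> = (if x = y then 0 else 1)"
    using assms(1,2) less.prems by (simp add: less_le)
  finally have "g y = (if x = y then 1 else 0)" using * by (simp split: if_splits)
  then show ?case unfolding g_def .
qed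

text \<open>
  Interchanging the two sums leaves for each \<open>f\<close> the sum of \<open>\<mu>(f, h)\<close> over the interval from \<open>f\<close> to \<open>e\<close>, so
  the defining recursion of \<open>\<mu>\<close> suffices here.
\<close>

lemma moebius_inversion:
  fixes F :: "'b::order \<Rightarrow> 'a::comm_ring_1"
  assumes "finite P" "e \<in> P"
  shows "(\<Sum>h\<in>{h \<in> P. h \<le> e}. \<Sum>f\<in>{f \<in> P. f \<le> h}. of_int (moebius P f h) * F f) = F e"
proof -
  let ?I = "{h \<in> P. h \<le> e}"
  have "(\<Sum>h\<in>?I. \<Sum>f\<in>{f \<in> P. f \<le> h}. of_int (moebius P f h) * F f)
      = (\<Sum>h\<in>?I. \<Sum>f\<in>{f \<in> ?I. f \<le> h}. of_int (moebius P f h) * F f)"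
    by (intro sum.cong refl) auto
  also have "\<dots> = (\<Sum>f\<in>?I. \<Sum>h\<in>{h \<in> ?I. f \<le> h}. of_int (moebius P f h) * F f)"
    by (rule sum.swap_restrict) (use assms in auto)
  also have "\<dots> = (\<Sum>f\<in>?I. of_int (\<Sum>h\<in>{h \<in> ?I. f \<le> h}. moebius P f h) * F f)"
    by (simp add: sum_distrib_right)
  also have "\<dots> = (\<Sum>f\<in>?I. if f = e then F f else 0)"
  proof (intro sum.cong refl)
    fix f assume f: "f \<in> ?I"
    then have "{h \<in> ?I. f \<le> h} = {h \<in> P. f \<le> h \<and> h \<le> e}" by auto
    then show "of_int (\<Sum>h\<in>{h \<in> ?I. f \<le> h}. moebius P f h) * F f = (if f = e then F f else 0)"
      using sum_moebius_upper[of P f e] f assms by simp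
  qed
  also have "\<dots> = F e" using assms by simp
  finally show ?thesis .
qed

text \<open>
  A form of Weisner's theorem: in the algebra of a finite meet semilattice, \<open>\<Sum>h\<le>e. \<mu>(h, e) h\<close> is
  annihilated by every \<open>f\<close> that is not above \<open>e\<close>. By inversion the elements of the semilattice below
  \<open>e\<close> contribute \<open>F (inf e f)\<close> altogether, and by induction that is already the contribution of those
  strictly below \<open>e\<close>.
\<close>

lemma weisner:
  fixes F :: "'b::semilattice_inf \<Rightarrow> 'a::comm_ring_1"
  assumes "finite P" and inf_closed: "\<And>x y. x \<in> P \<Longrightarrow> y \<in> P \<Longrightarrow> inf x y \<in> P"
    and "e \<in> P" "f \<in> P" "\<not> e \<le> f"
  shows "(\<Sum>h\<in>{h \<in> P. h \<le> e}. of_int (moebius P h e) * F (inf h f)) = 0"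
  using assms(3,5)
proof (induction "card {z \<in> P. z < e}" arbitrary: e rule: less_induct)
  case less
  \<comment> \<open>\<open>G\<close> and \<open>G'\<close> are the Moebius transforms of \<open>F\<close> and of \<open>h \<mapsto> F (inf h f)\<close>; they agree below \<open>f\<close>, and by
    induction \<open>G'\<close> vanishes at the elements strictly below \<open>e\<close> that are not below \<open>f\<close>.\<close>
  define G where "G e = (\<Sum>h\<in>{h \<in> P. h \<le> e}. of_int (moebius P h e) * F h)" for e
  define G' where "G' e = (\<Sum>h\<in>{h \<in> P. h \<le> e}. of_int (moebius P h e) * F (inf h f))" for e
  have IH: "G' z = 0" if "z \<in> P" "z < e" "\<not> z \<le> f" for z
  proof -
    have "{w \<in> P. w < z} \<subset> {w \<in> P. w < e}" using that by auto
    then have "card {w \<in> P. w < z} < card {w \<in> P. w < e}"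
      by (intro psubset_card_mono) (use assms in auto)
    from less.hyps[OF this] that show ?thesis unfolding G'_def by simp
  qed
  have below: "G' z = G z" if "z \<le> f" for z
    unfolding G_def G'_def
    by (intro sum.cong refl) (use that in \<open>auto simp: inf_absorb1 dest: order_trans\<close>)
  have "F (inf e f) = (\<Sum>h\<in>{h \<in> P. h \<le> e}. G' h)"
    unfolding G'_def using moebius_inversion[OF assms(1) less.prems(1), of "\<lambda>h. F (inf h f)"] by simp
  also have "{h \<in> P. h \<le> e} = insert e {h \<in> P. h < e}" using less.prems by (auto simp: le_less)
  also have "(\<Sum>h\<in>\<dots>. G' h) = G' e + (\<Sum>h\<in>{h \<in> P. h < e}. G' h)" using assms(1) by simp
  also have "(\<Sum>h\<in>{h \<in> P. h < e}. G' h) = (\<Sum>h\<in>{h \<in> P. h \<le> inf e f}. G h)"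
    by (rule sum.mono_neutral_cong_right)
      (use assms(1) less.prems IH below in \<open>auto simp: le_less_trans less_le\<close>)
  also have "\<dots> = F (inf e f)"
    unfolding G_def using moebius_inversion[OF assms(1), of "inf e f" F] inf_closed less.prems assms(4) by simp
  finally show ?case unfolding G'_def by simp
qed

section \<open>Alternating maps and minors\<close>

lemma vec_tuples_update: "vs \<in> vec_tuples n p \<Longrightarrow> u \<in> carrier_vec n \<Longrightarrow> vs[i := u] \<in> vec_tuples n p"
  using set_update_subset_insert[of vs i u] by (auto simp: vec_tuples_def)

lemma alternating_mapD:
  assumes "alternating_map n p m f" "vs \<in> vec_tuples n p"
  shows "f vs \<in> carrier_vec m"
    and "i < p \<Longrightarrow> u \<in> carrier_vec n \<Longrightarrow> v \<in> carrier_vec n \<Longrightarrow>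
      f (vs[i := u + v]) = f (vs[i := u]) + f (vs[i := v])"
    and "i < p \<Longrightarrow> u \<in> carrier_vec n \<Longrightarrow> f (vs[i := c \<cdot>\<^sub>v u]) = c \<cdot>\<^sub>v f (vs[i := u])"
    and "i < p \<Longrightarrow> j < p \<Longrightarrow> i \<noteq> j \<Longrightarrow> vs ! i = vs ! j \<Longrightarrow> f vs = 0\<^sub>v m"
  using assms unfolding alternating_map_def by blast+

text \<open>
  With \<open>F u v\<close> the value of \<open>f\<close> after placing \<open>u\<close> and \<open>v\<close> at positions \<open>i\<close> and \<open>j\<close>, expand \<open>F (a + b) (a + b) = 0\<close>.
\<close>

lemma alternating_map_swap:
  assumes f: "alternating_map n p m f" and vs: "vs \<in> vec_tuples n p" and ij: "i < p" "j < p" "i \<noteq> j"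
  shows "f (vs[i := vs ! j, j := vs ! i]) = - f vs"
proof -
  define F where "F u v = f (vs[i := u, j := v])" for u v
  let ?a = "vs ! i" and ?b = "vs ! j"
  have len: "length vs = p" using vs by (simp add: vec_tuples_def)
  have ab: "?a \<in> carrier_vec n" "?b \<in> carrier_vec n"
    using vs ij by (auto simp: vec_tuples_def)
  have mem: "vs[i := u, j := v] \<in> vec_tuples n p" if "u \<in> carrier_vec n" "v \<in> carrier_vec n" for u v
    using that vs by (simp add: vec_tuples_update)
  have F: "F u v \<in> carrier_vec m" if "u \<in> carrier_vec n" "v \<in> carrier_vec n" for u v
    unfolding F_def using alternating_mapD(1)[OF f] mem that by blast
  have diag: "F u u = 0\<^sub>v m" if "u \<in> carrier_vec n" for u
    unfolding F_def by (rule alternating_mapD(4)[OF f mem, of _ _ i j]) (use that ij len in auto)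
  have right: "F u (v + v') = F u v + F u v'"
    if "u \<in> carrier_vec n" "v \<in> carrier_vec n" "v' \<in> carrier_vec n" for u v v'
    unfolding F_def by (rule alternating_mapD(2)[OF f]) (use that ij vs vec_tuples_update in auto)
  have left: "F (u + u') v = F u v + F u' v"
    if "u \<in> carrier_vec n" "u' \<in> carrier_vec n" "v \<in> carrier_vec n" for u u' v
    unfolding F_def list_update_swap[OF ij(3)]
    by (rule alternating_mapD(2)[OF f]) (use that ij vs vec_tuples_update in auto)
  have "F (?a + ?b) (?a + ?b) = F ?a (?a + ?b) + F ?b (?a + ?b)"
    using ab by (intro left) auto
  also have "\<dots> = (F ?a ?a + F ?a ?b) + (F ?b ?a + F ?b ?b)"
    using ab by (simp add: right)
  finally have "F (?a + ?b) (?a + ?b) = (F ?a ?a + F ?a ?b) + (F ?b ?a + F ?b ?b)" .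
  then have "0\<^sub>v m = F ?a ?b + F ?b ?a"
    using ab F[OF ab] F[OF ab(2,1)] by (simp add: diag)
  then have "F ?a ?b $ k + F ?b ?a $ k = 0" if "k < m" for k
    using F[OF ab(2,1)] that by (metis carrier_vecD index_add_vec(1) index_zero_vec(1))
  then have "F ?b ?a = - F ?a ?b"
    using F[OF ab] F[OF ab(2,1)] by (intro eq_vecI) (auto simp: add_eq_0_iff)
  then show ?thesis unfolding F_def by simp
qed

lemma alternating_map_permute:
  assumes f: "alternating_map n p m f" and "\<pi> permutes {..<p}"
    and "vs \<in> vec_tuples n p"
  shows "f (map (\<lambda>i. vs ! \<pi> i) [0..<p]) = of_int (sign \<pi>) \<cdot>\<^sub>v f vs"
  using assms(2) finite_lessThan assms(3)
proof (induction \<pi> arbitrary: vs rule: permutes_induct)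
  case id
  then have "map (\<lambda>i. vs ! id i) [0..<p] = vs" by (auto simp: vec_tuples_def intro: map_nth)
  then show ?case by simp
next
  case (swap a b \<pi>)
  let ?ws = "map (\<lambda>i. vs ! Transposition.transpose a b i) [0..<p]"
  have len: "length vs = p" using swap.prems by (simp add: vec_tuples_def)
  have ws: "?ws = vs[a := vs ! b, b := vs ! a]"
    by (rule nth_equalityI) (use len swap.hyps in \<open>auto simp: nth_list_update Transposition.transpose_def\<close>)
  have mem: "?ws \<in> vec_tuples n p" unfolding ws
    using swap.prems swap.hyps by (intro vec_tuples_update) (auto simp: vec_tuples_def)
  have "map (\<lambda>i. vs ! (Transposition.transpose a b \<circ> \<pi>) i) [0..<p] = map (\<lambda>i. ?ws ! \<pi> i) [0..<p]"
    using permutes_in_image[OF swap.hyps(4)] by simp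
  also have "f \<dots> = of_int (sign \<pi>) \<cdot>\<^sub>v f ?ws" by (rule swap.IH[OF mem])
  also have "f ?ws = - f vs"
    unfolding ws using alternating_map_swap[OF f swap.prems] swap.hyps by simp
  also have "sign (Transposition.transpose a b \<circ> \<pi>) = - sign \<pi>"
    using swap.hyps permutes_imp_permutation[OF finite_lessThan swap.hyps(4)]
    by (simp add: sign_compose permutation_swap_id sign_swap_id)
  then have "of_int (sign \<pi>) \<cdot>\<^sub>v - f vs = of_int (sign (Transposition.transpose a b \<circ> \<pi>)) \<cdot>\<^sub>v f vs"
    by (intro eq_vecI) auto
  finally show ?case .
qed

text \<open>
  The vector \<open>v\<close> is built up from its truncations \<open>t k\<close>, one coordinate at a time.
\<close>

lemma linear_maps_eqI:
  fixes g h :: "'a::field vec \<Rightarrow> 'a vec"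
  assumes "\<And>u v. u \<in> carrier_vec n \<Longrightarrow> v \<in> carrier_vec n \<Longrightarrow> g (u + v) = g u + g v"
    and "\<And>u v. u \<in> carrier_vec n \<Longrightarrow> v \<in> carrier_vec n \<Longrightarrow> h (u + v) = h u + h v"
    and "\<And>c u. u \<in> carrier_vec n \<Longrightarrow> g (c \<cdot>\<^sub>v u) = c \<cdot>\<^sub>v g u"
    and "\<And>c u. u \<in> carrier_vec n \<Longrightarrow> h (c \<cdot>\<^sub>v u) = c \<cdot>\<^sub>v h u"
    and "\<And>u. u \<in> carrier_vec n \<Longrightarrow> g u \<in> carrier_vec m"
    and "\<And>u. u \<in> carrier_vec n \<Longrightarrow> h u \<in> carrier_vec m"
    and "\<And>j. j < n \<Longrightarrow> g (unit_vec n j) = h (unit_vec n j)"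
    and v: "v \<in> carrier_vec n"
  shows "g v = h v"
proof -
  define t where "t k = vec n (\<lambda>j. if j < k then v $ j else 0)" for k
  have t: "t k \<in> carrier_vec n" for k unfolding t_def by simp
  have "k \<le> n \<Longrightarrow> g (t k) = h (t k)" for k
  proof (induction k)
    case 0
    have "t 0 = 0 \<cdot>\<^sub>v t 0" unfolding t_def by (intro eq_vecI) auto
    then have "g (t 0) = 0 \<cdot>\<^sub>v g (t 0)" "h (t 0) = 0 \<cdot>\<^sub>v h (t 0)"
      using assms(3,4)[OF t] by metis+
    moreover have "g (t 0) \<in> carrier_vec m" "h (t 0) \<in> carrier_vec m" using assms(5,6) t by auto
    moreover have "0 \<cdot>\<^sub>v u = 0\<^sub>v m" if "u \<in> carrier_vec m" for u :: "'a vec"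
      using that by (intro eq_vecI) auto
    ultimately show ?case by metis
  next
    case (Suc k)
    have "t (Suc k) = t k + (v $ k) \<cdot>\<^sub>v unit_vec n k"
      unfolding t_def using Suc.prems by (intro eq_vecI) (auto simp: less_Suc_eq)
    then show ?case using Suc t[of k] by (simp add: assms(1-4) assms(7))
  qed
  from this[of n] have "g (t n) = h (t n)" by simp
  moreover have "t n = v" unfolding t_def using v by (intro eq_vecI) auto
  ultimately show ?thesis by simp
qed

text \<open>
  The \<open>p\<close>-subsets of \<open>{..<n}\<close>, each listed in increasing order. They index the standard basis of the
  exterior power, and a list of them (instead of a set) numbers the coordinates.
\<close>

definition index_lists :: "nat \<Rightarrow> nat \<Rightarrow> nat list list" where
  "index_lists n p = filter (sorted_wrt (<)) (List.n_lists p [0..<n])"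

lemma set_index_lists:
  "set (index_lists n p) = {xs. sorted_wrt (<) xs \<and> length xs = p \<and> set xs \<subseteq> {..<n}}"
  by (auto simp: index_lists_def set_n_lists)

lemma distinct_index_lists: "distinct (index_lists n p)"
  by (simp add: index_lists_def distinct_n_lists)

text \<open>
  An alternating map is determined by its values at the increasing tuples of standard basis vectors:
  at other tuples of basis vectors it is zero or, after sorting, agrees up to a sign; and the general
  case follows by expanding one argument after another.
\<close>

lemma alternating_maps_eqI:
  fixes f g :: "'a::field vec list \<Rightarrow> 'a vec"
  assumes f: "alternating_map n p m f" and g: "alternating_map n p m g"
    and eq: "\<And>xs. xs \<in> set (index_lists n p) \<Longrightarrow> f (map (unit_vec n) xs) = g (map (unit_vec n) xs)"
    and vs: "vs \<in> vec_tuples n p"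
  shows "f vs = g vs"
proof -
  have units: "map (unit_vec n) xs \<in> vec_tuples n p" if "length xs = p" for xs
    using that by (auto simp: vec_tuples_def)
  have basis: "f (map (unit_vec n) xs) = g (map (unit_vec n) xs)"
    if xs: "length xs = p" "set xs \<subseteq> {..<n}" for xs
  proof (cases "distinct xs")
    case True
    have "sorted_wrt (<) (sort xs)"
      using True by (simp add: strict_sorted_iff)
    then have srt: "sort xs \<in> set (index_lists n p)"
      using xs by (simp add: set_index_lists)
    obtain \<pi> where \<pi>: "\<pi> permutes {..<p}" "permute_list \<pi> (sort xs) = xs"
      using mset_eq_permutation[of xs "sort xs"] xs(1) by auto
    have "map (unit_vec n :: nat \<Rightarrow> 'a vec) xs = map (\<lambda>i. map (unit_vec n) (sort xs) ! \<pi> i) [0..<p]"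
      using permutes_in_image[OF \<pi>(1)] xs(1)
      by (subst \<pi>(2)[symmetric]) (simp add: permute_list_def)
    then show ?thesis
      using alternating_map_permute[OF f \<pi>(1) units, of "sort xs"]
        alternating_map_permute[OF g \<pi>(1) units, of "sort xs"] xs(1) eq[OF srt] by simp
  next
    case False
    then obtain i j where "i < p" "j < p" "i \<noteq> j" "xs ! i = xs ! j"
      using xs(1) by (auto simp: distinct_conv_nth)
    then show ?thesis
      using alternating_mapD(4)[OF f units[OF xs(1)], of i j]
        alternating_mapD(4)[OF g units[OF xs(1)], of i j] xs(1) by simp
  qed
  \<comment> \<open>The entries from position \<open>k\<close> on are basis vectors; linearity in position \<open>k\<close> frees that entry.\<close>
  have "f vs = g vs" if "k \<le> p" "vs \<in> vec_tuples n p"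
    "\<forall>i. k \<le> i \<and> i < p \<longrightarrow> vs ! i \<in> unit_vec n ` {..<n}" for k vs
    using that
  proof (induction k arbitrary: vs)
    case 0
    then have "vs \<in> lists (unit_vec n ` {..<n})"
      by (auto simp: in_set_conv_nth vec_tuples_def)
    then obtain xs where "vs = map (unit_vec n) xs" "set xs \<subseteq> {..<n}"
      by (auto simp: lists_image)
    then show ?case using basis[of xs] 0 by (simp add: vec_tuples_def)
  next
    case (Suc k)
    have len: "length vs = p" using Suc.prems by (simp add: vec_tuples_def)
    have vk: "vs ! k \<in> carrier_vec n" using Suc.prems by (auto simp: vec_tuples_def)
    have "f (vs[k := vs ! k]) = g (vs[k := vs ! k])"
    proof (rule linear_maps_eqI[where n = n and m = m
          and g = "\<lambda>u. f (vs[k := u])" and h = "\<lambda>u. g (vs[k := u])"])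
      fix j assume "j < n"
      then show "f (vs[k := unit_vec n j]) = g (vs[k := unit_vec n j])"
        using Suc.prems len
        by (intro Suc.IH vec_tuples_update) (auto simp: nth_list_update)
    qed (use Suc.prems len vk in \<open>auto intro!: vec_tuples_update
       alternating_mapD(1)[OF f] alternating_mapD(1)[OF g] alternating_mapD(2)[OF f]
       alternating_mapD(2)[OF g] alternating_mapD(3)[OF f] alternating_mapD(3)[OF g]\<close>)
    then show ?case by simp
  qed
  from this[of p vs] vs show ?thesis using linorder_not_less by blast
qed

text \<open>
  The coefficient of the basis element with index list \<open>xs\<close> in \<open>v\<^sub>1 \<and> \<dots> \<and> v\<^sub>p\<close>.
\<close>

definition minor :: "nat list \<Rightarrow> 'a::field vec list \<Rightarrow> 'a" where
  "minor xs vs = det (mat (length xs) (length xs) (\<lambda>(i, j). vs ! i $ (xs ! j)))"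

text \<open>
  The Leibniz formula with the factor of row \<open>i\<close> split off, which displays the linearity in that row.
\<close>

lemma minor_update:
  assumes i: "i < length xs" and "length vs = length xs"
  shows "minor xs (vs[i := u]) = (\<Sum>\<pi> | \<pi> permutes {0..<length xs}.
    signof \<pi> * (u $ (xs ! \<pi> i) * (\<Prod>a\<in>{0..<length xs} - {i}. vs ! a $ (xs ! \<pi> a))))"
proof -
  have "(\<Prod>a = 0..<length xs. mat (length xs) (length xs) (\<lambda>(a, b). vs[i := u] ! a $ (xs ! b)) $$ (a, \<pi> a))
      = u $ (xs ! \<pi> i) * (\<Prod>a\<in>{0..<length xs} - {i}. vs ! a $ (xs ! \<pi> a))"
    if \<pi>: "\<pi> permutes {0..<length xs}" for \<pi>
  proof -
    have lt: "\<pi> a < length xs" if "a < length xs" for a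
      using permutes_in_image[OF \<pi>, of a] that by simp
    show ?thesis
      using assms by (subst prod.remove[of _ i]) (auto simp: lt intro!: prod.cong)
  qed
  then show ?thesis
    unfolding minor_def by (subst det_def'[of _ "length xs"]) (auto intro!: sum.cong)
qed

lemma minor_update_add:
  assumes "i < length xs" "length vs = length xs" "set xs \<subseteq> {..<n}"
    and "u \<in> carrier_vec n" "v \<in> carrier_vec n"
  shows "minor xs (vs[i := u + v]) = minor xs (vs[i := u]) + minor xs (vs[i := v])"
proof -
  have "(u + v) $ (xs ! \<pi> i) = u $ (xs ! \<pi> i) + v $ (xs ! \<pi> i)" if "\<pi> permutes {0..<length xs}" for \<pi>
  proof -
    have "xs ! \<pi> i \<in> set xs" using permutes_in_image[OF that, of i] assms(1) by (intro nth_mem) simp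
    then show ?thesis using assms by (intro index_add_vec) auto
  qed
  then show ?thesis
    unfolding minor_update[OF assms(1,2)] sum.distrib[symmetric]
    by (intro sum.cong refl) (simp add: distrib_left distrib_right)
qed

lemma minor_update_smult:
  assumes "i < length xs" "length vs = length xs" "set xs \<subseteq> {..<n}" "u \<in> carrier_vec n"
  shows "minor xs (vs[i := c \<cdot>\<^sub>v u]) = c * minor xs (vs[i := u])"
proof -
  have "(c \<cdot>\<^sub>v u) $ (xs ! \<pi> i) = c * u $ (xs ! \<pi> i)" if "\<pi> permutes {0..<length xs}" for \<pi>
  proof -
    have "xs ! \<pi> i \<in> set xs" using permutes_in_image[OF that, of i] assms(1) by (intro nth_mem) simp
    then show ?thesis using assms by (intro index_smult_vec) auto
  qed
  then show ?thesis
    unfolding minor_update[OF assms(1,2)] sum_distrib_left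
    by (intro sum.cong refl) simp
qed

lemma minor_eq_0_if_missing:
  assumes "length vs = length xs" "i < length xs" "\<And>j. j < length xs \<Longrightarrow> vs ! i $ (xs ! j) = 0"
  shows "minor xs vs = 0"
proof -
  have "minor xs (vs[i := vs ! i]) = 0"
    using assms(3) permutes_in_image[of _ "{0..<length xs}" i] assms(2)
    by (subst minor_update) (use assms in \<open>auto intro!: sum.neutral\<close>)
  then show ?thesis by simp
qed

definition minors :: "nat \<Rightarrow> nat \<Rightarrow> 'a::field vec list \<Rightarrow> 'a vec" where
  "minors n p vs = vec (length (index_lists n p)) (\<lambda>k. minor (index_lists n p ! k) vs)"

lemma alternating_minors: "alternating_map n p (length (index_lists n p)) (minors n p)"
proof -
  have len: "length (index_lists n p ! k) = p" "set (index_lists n p ! k) \<subseteq> {..<n}"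
    if "k < length (index_lists n p)" for k
    using nth_mem[OF that] by (auto simp: set_index_lists)
  show ?thesis
    unfolding alternating_map_def
  proof (intro ballI conjI allI impI)
    fix vs :: "'a vec list" and i and u v :: "'a vec"
    assume *: "vs \<in> vec_tuples n p" "i < p" "u \<in> carrier_vec n" "v \<in> carrier_vec n"
    then have "minor (index_lists n p ! k) (vs[i := u + v])
        = minor (index_lists n p ! k) (vs[i := u]) + minor (index_lists n p ! k) (vs[i := v])"
      if "k < length (index_lists n p)" for k
      using len[OF that] by (intro minor_update_add) (auto simp: vec_tuples_def)
    then show "minors n p (vs[i := u + v]) = minors n p (vs[i := u]) + minors n p (vs[i := v])"
      by (intro eq_vecI) (simp_all add: minors_def)
  next
    fix vs :: "'a vec list" and i and c and u :: "'a vec"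
    assume *: "vs \<in> vec_tuples n p" "i < p" "u \<in> carrier_vec n"
    then have "minor (index_lists n p ! k) (vs[i := c \<cdot>\<^sub>v u]) = c * minor (index_lists n p ! k) (vs[i := u])"
      if "k < length (index_lists n p)" for k
      using len[OF that] by (intro minor_update_smult) (auto simp: vec_tuples_def)
    then show "minors n p (vs[i := c \<cdot>\<^sub>v u]) = c \<cdot>\<^sub>v minors n p (vs[i := u])"
      by (intro eq_vecI) (simp_all add: minors_def)
  next
    fix vs :: "'a vec list" and i j
    assume *: "vs \<in> vec_tuples n p" "i < p" "j < p" "i \<noteq> j \<and> vs ! i = vs ! j"
    have "minor (index_lists n p ! k) vs = 0" if k: "k < length (index_lists n p)" for k
      unfolding minor_def len(1)[OF k]
      by (rule det_identical_rows[of _ p i j]) (use * in \<open>auto intro!: eq_vecI\<close>)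
    then show "minors n p vs = 0\<^sub>v (length (index_lists n p))"
      unfolding minors_def by (intro eq_vecI) auto
  qed (simp add: minors_def)
qed

lemma increasing_lists_eqI:
  fixes xs ys :: "nat list"
  assumes "sorted_wrt (<) xs" "sorted_wrt (<) ys" "length xs = length ys" "set ys \<subseteq> set xs"
  shows "xs = ys"
proof -
  have d: "distinct xs" "distinct ys" "sorted xs" "sorted ys" using assms by (simp_all add: strict_sorted_iff)
  then have "set ys = set xs"
    using assms(3,4) by (intro card_subset_eq) (auto simp: distinct_card)
  then show ?thesis using d by (metis sorted_distinct_set_unique)
qed

text \<open>
  If \<open>ys \<noteq> xs\<close>, then some entry of \<open>ys\<close> is missing from \<open>xs\<close>, and its row in the minor is zero.
\<close>

lemma minor_unit_vecs:
  assumes "xs \<in> set (index_lists n p)" "ys \<in> set (index_lists n p)"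
  shows "minor xs (map (unit_vec n) ys) = (if xs = ys then 1 else 0 :: 'a::field)"
proof -
  have xs: "sorted_wrt (<) xs" "length xs = p" "\<And>j. j < p \<Longrightarrow> xs ! j < n"
    and ys: "sorted_wrt (<) ys" "length ys = p" "\<And>j. j < p \<Longrightarrow> ys ! j < n"
    using assms by (auto simp: set_index_lists subset_iff)
  show ?thesis
  proof (cases "xs = ys")
    case True
    have "distinct xs" using xs by (simp add: strict_sorted_iff)
    then have "mat (length xs) (length xs) (\<lambda>(i, j). map (unit_vec n :: nat \<Rightarrow> 'a vec) ys ! i $ (xs ! j)) = 1\<^sub>m (length xs)"
      using True xs by (intro eq_matI) (auto simp: nth_eq_iff_index_eq)
    with True show ?thesis by (simp add: minor_def)
  next
    case False
    then have "\<not> set ys \<subseteq> set xs" using increasing_lists_eqI xs ys by metis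
    then obtain i where i: "i < p" "ys ! i \<notin> set xs" using ys(2) by (metis in_set_conv_nth subsetI)
    have "minor xs (map (unit_vec n) ys) = (0 :: 'a)"
    proof (rule minor_eq_0_if_missing[of _ _ i])
      fix j assume j: "j < length xs"
      then have "xs ! j \<noteq> ys ! i" using i(2) nth_mem by metis
      then show "map (unit_vec n) ys ! i $ (xs ! j) = (0 :: 'a)" using i xs ys j by simp
    qed (use i xs ys in auto)
    with False show ?thesis by simp
  qed
qed

section \<open>Coordinates and traces on an exterior power\<close>

lemma mat_mult_unit_vec:
  fixes A :: "'a::semiring_1 mat"
  assumes "A \<in> carrier_mat k l" "j < l"
  shows "A *\<^sub>v unit_vec l j = col A j"
  using assms by (intro eq_vecI) auto

lemma minors_unit_vecs:
  assumes "k < length (index_lists n p)"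
  shows "minors n p (map (unit_vec n) (index_lists n p ! k)) = unit_vec (length (index_lists n p)) k"
proof (rule eq_vecI)
  fix l assume "l < dim_vec (unit_vec (length (index_lists n p)) k :: 'a vec)"
  then have l: "l < length (index_lists n p)" by simp
  show "minors n p (map (unit_vec n) (index_lists n p ! k)) $ l
      = (unit_vec (length (index_lists n p)) k :: 'a vec) $ l"
    using assms l nth_eq_iff_index_eq[OF distinct_index_lists l assms]
    by (auto simp: minors_def minor_unit_vecs[where p = p] index_unit_vec)
qed (simp add: minors_def)

lemma alternating_map_mat:
  assumes f: "alternating_map n p m f" and M: "M \<in> carrier_mat l m"
  shows "alternating_map n p l (\<lambda>vs. M *\<^sub>v f vs)"
  unfolding alternating_map_def
proof (intro ballI conjI allI impI)
  fix vs :: "'a vec list" assume vs: "vs \<in> vec_tuples n p"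
  have upd: "f (vs[i := u]) \<in> carrier_vec m" if "u \<in> carrier_vec n" for i and u :: "'a vec"
    using alternating_mapD(1)[OF f vec_tuples_update[OF vs that]] .
  show "M *\<^sub>v f vs \<in> carrier_vec l" using M alternating_mapD(1)[OF f vs] by auto
  fix i assume i: "i < p"
  {
    fix u v :: "'a vec" assume uv: "u \<in> carrier_vec n" "v \<in> carrier_vec n"
    show "M *\<^sub>v f (vs[i := u + v]) = M *\<^sub>v f (vs[i := u]) + M *\<^sub>v f (vs[i := v])"
      unfolding alternating_mapD(2)[OF f vs i uv]
      by (rule mult_add_distrib_mat_vec[OF M]) (use upd uv in auto)
  next
    fix c and u :: "'a vec" assume u: "u \<in> carrier_vec n"
    show "M *\<^sub>v f (vs[i := c \<cdot>\<^sub>v u]) = c \<cdot>\<^sub>v (M *\<^sub>v f (vs[i := u]))"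
      unfolding alternating_mapD(3)[OF f vs i u]
      by (rule mult_mat_vec[OF M]) (use upd u in auto)
  next
    fix j assume "j < p" "i \<noteq> j \<and> vs ! i = vs ! j"
    then have "f vs = 0\<^sub>v m" using alternating_mapD(4)[OF f vs i] by blast
    then show "M *\<^sub>v f vs = 0\<^sub>v l" using M by auto
  }
qed

text \<open>
  Both matrices solve the factorisation problem for the alternating map \<open>B \<circ> w\<close>; so the uniqueness in
  the universal property expresses that the image of \<open>w\<close> spans.
\<close>

lemma exterior_power_mat_eqI:
  assumes w: "is_exterior_power n p d w" and A: "A \<in> carrier_mat m d" and B: "B \<in> carrier_mat m d"
    and eq: "\<And>vs. vs \<in> vec_tuples n p \<Longrightarrow> A *\<^sub>v w vs = B *\<^sub>v w vs"
  shows "A = B"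
proof -
  have "alternating_map n p d w" using w by (simp add: is_exterior_power_def)
  from alternating_map_mat[OF this B]
  have "\<exists>!M. M \<in> carrier_mat m d \<and> (\<forall>vs\<in>vec_tuples n p. B *\<^sub>v w vs = M *\<^sub>v w vs)"
    using w unfolding is_exterior_power_def by blast
  moreover have "A \<in> carrier_mat m d \<and> (\<forall>vs\<in>vec_tuples n p. B *\<^sub>v w vs = A *\<^sub>v w vs)"
    using A eq by simp
  moreover have "B \<in> carrier_mat m d \<and> (\<forall>vs\<in>vec_tuples n p. B *\<^sub>v w vs = B *\<^sub>v w vs)"
    using B by simp
  ultimately show ?thesis by blast
qed

text \<open>
  An abstract exterior power is identified with the concrete one by minors. The matrix \<open>B\<close> comes from the
  universal property applied to the alternating map of all minors, and \<open>C\<close> has as columns the values of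
  \<open>w\<close> at the increasing tuples of standard basis vectors. That \<open>B C = 1\<close> is seen on basis vectors. The
  alternating maps \<open>w\<close> and \<open>C \<circ> minors n p\<close> agree at increasing tuples of basis vectors, hence everywhere,
  and uniqueness in the universal property turns this into \<open>C B = 1\<close>.
\<close>

lemma exterior_power_basis:
  fixes w :: "'a::field vec list \<Rightarrow> 'a vec"
  assumes w: "is_exterior_power n p d w"
  defines "N \<equiv> length (index_lists n p)"
  shows "\<exists>B C. B \<in> carrier_mat N d \<and> C \<in> carrier_mat d N \<and> B * C = 1\<^sub>m N \<and> C * B = 1\<^sub>m d \<and>
    (\<forall>vs\<in>vec_tuples n p. B *\<^sub>v w vs = minors n p vs) \<and>
    (\<forall>k<N. col C k = w (map (unit_vec n) (index_lists n p ! k)))"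
proof -
  have alt: "alternating_map n p d w" using w by (simp add: is_exterior_power_def)
  have units: "map (unit_vec n) (index_lists n p ! k) \<in> (vec_tuples n p :: 'a vec list set)" if "k < N" for k
    using nth_mem[OF that[unfolded N_def]] by (auto simp: vec_tuples_def set_index_lists)
  have wc: "w vs \<in> carrier_vec d" if "vs \<in> vec_tuples n p" for vs
    using alternating_mapD(1)[OF alt that] .
  have "\<exists>!B. B \<in> carrier_mat N d \<and> (\<forall>vs\<in>vec_tuples n p. minors n p vs = B *\<^sub>v w vs)"
    using w[unfolded is_exterior_power_def, THEN conjunct2, rule_format, OF alternating_minors]
    unfolding N_def .
  from ex1_implies_ex[OF this] obtain B where
    *: "B \<in> carrier_mat N d \<and> (\<forall>vs\<in>vec_tuples n p. minors n p vs = B *\<^sub>v w vs)"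
    by (rule exE)
  have B: "B \<in> carrier_mat N d" using * by (rule conjunct1)
  have Bw: "minors n p vs = B *\<^sub>v w vs" if "vs \<in> vec_tuples n p" for vs
    using bspec[OF conjunct2[OF *] that] .
  define C where "C = mat_of_cols d (map (\<lambda>xs. w (map (unit_vec n) xs)) (index_lists n p))"
  have C: "C \<in> carrier_mat d N" unfolding C_def N_def by auto
  have colC: "col C k = w (map (unit_vec n) (index_lists n p ! k))" if "k < N" for k
    using that wc[OF units[OF that]] unfolding C_def N_def by (subst col_mat_of_cols) auto
  have unitC: "C *\<^sub>v unit_vec N k = col C k" if "k < N" for k
    using mat_mult_unit_vec[OF C that] .
  have "B * C = 1\<^sub>m N"
  proof (rule mat_col_eqI)
    fix k assume "k < dim_col (1\<^sub>m N :: 'a mat)"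
    then have k: "k < N" by simp
    have "col (B * C) k = B *\<^sub>v col C k" by (rule col_mult2[OF B C k])
    also have "\<dots> = unit_vec N k"
      unfolding colC[OF k] Bw[OF units[OF k], symmetric]
      using minors_unit_vecs k unfolding N_def by blast
    finally show "col (B * C) k = col (1\<^sub>m N) k" using k by simp
  qed (use B C in auto)
  moreover have "C * B = 1\<^sub>m d"
  proof (rule exterior_power_mat_eqI[OF w])
    fix vs :: "'a vec list" assume vs: "vs \<in> vec_tuples n p"
    have "alternating_map n p d (\<lambda>vs. C *\<^sub>v minors n p vs)"
      using alternating_map_mat[OF alternating_minors C[unfolded N_def]] .
    then have "C *\<^sub>v minors n p vs = w vs"
    proof (rule alternating_maps_eqI[OF _ alt _ vs])
      fix xs assume "xs \<in> set (index_lists n p)"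
      then obtain k where "k < N" "xs = index_lists n p ! k" unfolding N_def by (metis in_set_conv_nth)
      then show "C *\<^sub>v minors n p (map (unit_vec n) xs) = w (map (unit_vec n) xs)"
        using minors_unit_vecs[of k n p, where 'a = 'a] unitC colC by (simp add: N_def)
    qed
    then show "C * B *\<^sub>v w vs = 1\<^sub>m d *\<^sub>v w vs"
      using wc[OF vs] B C Bw[OF vs] by (simp add: assoc_mult_mat_vec[OF C B])
  qed (use B C in auto)
  ultimately show ?thesis
    using B C Bw colC by (intro exI[of _ B] exI[of _ C] conjI ballI allI impI) simp_all
qed

lemma trace_mult_commute:
  fixes A B :: "'a::comm_ring_1 mat"
  assumes "A \<in> carrier_mat k l" "B \<in> carrier_mat l k"
  shows "(\<Sum>i<k. (A * B) $$ (i, i)) = (\<Sum>j<l. (B * A) $$ (j, j))"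
proof -
  have "(\<Sum>i<k. (A * B) $$ (i, i)) = (\<Sum>i<k. \<Sum>j<l. A $$ (i, j) * B $$ (j, i))"
    using assms by (intro sum.cong refl) (auto simp: scalar_prod_def atLeast0LessThan)
  also have "\<dots> = (\<Sum>j<l. \<Sum>i<k. A $$ (i, j) * B $$ (j, i))" by (rule sum.swap)
  also have "\<dots> = (\<Sum>j<l. (B * A) $$ (j, j))"
    using assms by (intro sum.cong refl) (auto simp: scalar_prod_def atLeast0LessThan mult.commute)
  finally show ?thesis .
qed

text \<open>
  By cyclicity of the trace, \<open>\<rho> s = C B (\<rho> s)\<close> has the trace of \<open>B (\<rho> s) C\<close>, whose diagonal entries are the
  principal \<open>p \<times> p\<close> minors of \<open>R s\<close>.
\<close>

lemma character_exterior_power: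
  assumes \<rho>: "exterior_power_rep S n R p d \<rho>" and s: "s \<in> S" and R: "R s \<in> carrier_mat n n"
  shows "character \<rho> s = (\<Sum>xs\<in>set (index_lists n p). det (mat p p (\<lambda>(i, j). R s $$ (xs ! i, xs ! j))))"
proof -
  obtain w where w: "is_exterior_power n p d w" and \<rho>s: "\<rho> s \<in> carrier_mat d d"
    and \<rho>w: "\<And>vs. vs \<in> vec_tuples n p \<Longrightarrow> \<rho> s *\<^sub>v w vs = w (map (\<lambda>v. R s *\<^sub>v v) vs)"
    using \<rho> s unfolding exterior_power_rep_def by blast
  define L where "L = index_lists n p"
  define N where "N = length L"
  obtain B C where B: "B \<in> carrier_mat N d" and C: "C \<in> carrier_mat d N"
    and BC: "B * C = 1\<^sub>m N" and CB: "C * B = 1\<^sub>m d"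
    and Bw: "\<And>vs. vs \<in> vec_tuples n p \<Longrightarrow> B *\<^sub>v w vs = minors n p vs"
    and colC: "\<And>k. k < N \<Longrightarrow> col C k = w (map (unit_vec n) (L ! k))"
    using exterior_power_basis[OF w, folded L_def, folded N_def] by (elim exE conjE) (rule that; blast)
  have "character \<rho> s = (\<Sum>i<d. \<rho> s $$ (i, i))" using \<rho>s by (simp add: character_def)
  also have "\<rho> s = C * (B * \<rho> s)" using B C \<rho>s CB by (simp add: assoc_mult_mat[symmetric, OF C B])
  also have "(\<Sum>i<d. (C * (B * \<rho> s)) $$ (i, i)) = (\<Sum>k<N. (B * \<rho> s * C) $$ (k, k))"
    by (rule trace_mult_commute) (use B C \<rho>s in auto)
  also have "\<dots> = (\<Sum>k<N. det (mat p p (\<lambda>(i, j). R s $$ (L ! k ! i, L ! k ! j))))"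
  proof (intro sum.cong refl)
    fix k assume "k \<in> {..<N}"
    then have k: "k < N" by simp
    have xs: "length (L ! k) = p" "\<And>i. i < p \<Longrightarrow> L ! k ! i < n"
      using nth_mem[OF k[unfolded N_def]] by (auto simp: L_def set_index_lists subset_iff)
    let ?us = "map (unit_vec n) (L ! k)"
    have us: "?us \<in> vec_tuples n p" using xs(1) by (auto simp: vec_tuples_def)
    have "(B * \<rho> s * C) $$ (k, k) = col (B * \<rho> s * C) k $ k" using k B C \<rho>s by simp
    also have "col (B * \<rho> s * C) k = (B * \<rho> s) *\<^sub>v col C k"
      by (rule col_mult2[of _ _ d _ N]) (use B C \<rho>s k in auto)
    also have "\<dots> = B *\<^sub>v (\<rho> s *\<^sub>v w ?us)"
      unfolding colC[OF k, symmetric] by (rule assoc_mult_mat_vec) (use B C \<rho>s k in auto)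
    also have "\<dots> = minors n p (map (\<lambda>v. R s *\<^sub>v v) ?us)"
      unfolding \<rho>w[OF us] by (rule Bw) (use xs R in \<open>auto simp: vec_tuples_def\<close>)
    also have "\<dots> $ k = minor (L ! k) (map (\<lambda>v. R s *\<^sub>v v) ?us)"
      using k by (simp add: minors_def N_def L_def)
    also have "\<dots> = det (transpose_mat (mat p p (\<lambda>(i, j). R s $$ (L ! k ! i, L ! k ! j))))"
      unfolding minor_def using xs R
      by (intro arg_cong[where f = det] eq_matI) (auto simp: mat_mult_unit_vec)
    also have "\<dots> = det (mat p p (\<lambda>(i, j). R s $$ (L ! k ! i, L ! k ! j)))"
      by (rule det_transpose) auto
    finally show "(B * \<rho> s * C) $$ (k, k) = det (mat p p (\<lambda>(i, j). R s $$ (L ! k ! i, L ! k ! j)))" .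
  qed
  also have "\<dots> = (\<Sum>xs\<in>set L. det (mat p p (\<lambda>(i, j). R s $$ (xs ! i, xs ! j))))"
    by (rule sum.reindex_bij_betw) (use bij_betw_nth[of L] distinct_index_lists in \<open>auto simp: L_def N_def\<close>)
  finally show ?thesis unfolding L_def .
qed

section \<open>Inverse semigroups of partial permutations\<close>

lemma partial_permsD:
  assumes "\<sigma> \<in> partial_perms n"
  shows "(x, y) \<in> \<sigma> \<Longrightarrow> (x, z) \<in> \<sigma> \<Longrightarrow> y = z" and "(x, z) \<in> \<sigma> \<Longrightarrow> (y, z) \<in> \<sigma> \<Longrightarrow> x = y"
    and "(x, y) \<in> \<sigma> \<Longrightarrow> 1 \<le> x \<and> x \<le> n \<and> 1 \<le> y \<and> y \<le> n"
  using assms unfolding partial_perms_def single_valued_def by auto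

lemma finite_partial_perms: "finite (partial_perms n)"
  by (rule finite_subset[of _ "Pow ({1..n} \<times> {1..n})"]) (auto simp: partial_perms_def)

lemma Id_on_partial_perms: "X \<subseteq> {1..n} \<Longrightarrow> Id_on X \<in> partial_perms n"
  unfolding partial_perms_def single_valued_def by auto

lemma inverse_subsemigroup_partial_perms: "inverse_subsemigroup n (partial_perms n)"
  unfolding inverse_subsemigroup_def partial_perms_def
  by (auto simp: converse_relcomp intro: single_valued_relcomp)

lemma idempotent_is_partial_identity:
  assumes "\<sigma> \<in> partial_perms n" "\<sigma> O \<sigma> = \<sigma>"
  shows "\<sigma> = Id_on (Domain \<sigma>)"
proof -
  have "x = y" if xy: "(x, y) \<in> \<sigma>" for x y
  proof -
    from xy assms(2) obtain z where z: "(x, z) \<in> \<sigma>" "(z, y) \<in> \<sigma>" by blast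
    then have "z = y" using partial_permsD(1)[OF assms(1)] xy by blast
    then show "x = y" using partial_permsD(2)[OF assms(1)] xy z by blast
  qed
  then show ?thesis by (auto simp: Id_on_def)
qed

locale pperm_inverse_semigroup =
  fixes n :: nat and S :: "pperm set"
  assumes inverse_subsemigroup: "inverse_subsemigroup n S"
begin

lemma
  shows partial_perm: "s \<in> S \<Longrightarrow> s \<in> partial_perms n"
    and mult_closed: "s \<in> S \<Longrightarrow> t \<in> S \<Longrightarrow> s O t \<in> S"
    and inverse_closed: "s \<in> S \<Longrightarrow> s\<inverse> \<in> S"
  using inverse_subsemigroup unfolding inverse_subsemigroup_def by auto

lemma finite_S: "finite S"
  using finite_subset[OF _ finite_partial_perms] partial_perm by blast

lemma idempotent_in: "e \<in> idempotents S \<Longrightarrow> e \<in> S"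
  by (simp add: idempotents_def)

lemma Id_on_idempotent: "Id_on X \<in> S \<Longrightarrow> Id_on X \<in> idempotents S"
  by (auto simp: idempotents_def)

lemma idempotent_eq_Id_on: "e \<in> idempotents S \<Longrightarrow> e = Id_on (Domain e)"
  using idempotent_is_partial_identity[OF partial_perm, of e] by (auto simp: idempotents_def)

lemma finite_idempotents: "finite (idempotents S)"
  using finite_S by (simp add: idempotents_def)

lemma idempotents_inter:
  assumes "e \<in> idempotents S" "f \<in> idempotents S"
  shows "e O f = e \<inter> f" "e \<inter> f \<in> idempotents S"
proof -
  obtain X Y where XY: "e = Id_on X" "f = Id_on Y" using assms idempotent_eq_Id_on by metis
  then show *: "e O f = e \<inter> f" by auto
  have "e \<inter> f = Id_on (X \<inter> Y)" unfolding XY by auto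
  then show "e \<inter> f \<in> idempotents S"
    using mult_closed[of e f] assms[THEN idempotent_in] * by (metis Id_on_idempotent)
qed

lemma inverse_mult:
  assumes "s \<in> S"
  shows "s O s\<inverse> = Id_on (Domain s)" "s\<inverse> O s = Id_on (Range s)"
    "s O s\<inverse> \<in> idempotents S" "s\<inverse> O s \<in> idempotents S"
proof -
  note inj = partial_permsD[OF partial_perm[OF assms]]
  show 1: "s O s\<inverse> = Id_on (Domain s)" by (auto simp: Id_on_def dest: inj(2))
  show 2: "s\<inverse> O s = Id_on (Range s)" by (auto simp: Id_on_def dest: inj(1))
  show "s O s\<inverse> \<in> idempotents S" "s\<inverse> O s \<in> idempotents S"
    using mult_closed inverse_closed assms by (metis 1 2 Id_on_idempotent)+
qed

lemma idempotent_mult: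
  assumes "e \<in> idempotents S"
  shows "Domain s \<subseteq> Domain e \<Longrightarrow> e O s = s" and "Range s \<subseteq> Domain e \<Longrightarrow> s O e = s"
proof -
  obtain X where "e = Id_on X" using assms idempotent_eq_Id_on by metis
  then show "Domain s \<subseteq> Domain e \<Longrightarrow> e O s = s" "Range s \<subseteq> Domain e \<Longrightarrow> s O e = s" by auto
qed

lemma maximal_subgroup_iff:
  assumes "e \<in> idempotents S"
  shows "g \<in> maximal_subgroup S e \<longleftrightarrow> g \<in> S \<and> Domain g = Domain e \<and> Range g = Domain e"
proof -
  have *: "Id_on X = e \<longleftrightarrow> X = Domain e" for X using idempotent_eq_Id_on[OF assms] by (metis Domain_Id_on)
  show ?thesis
  proof (cases "g \<in> S")
    case True
    then show ?thesis
      by (simp only: maximal_subgroup_def mem_Collect_eq inverse_mult(1,2)[OF True] * simp_thms)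
  qed (simp add: maximal_subgroup_def)
qed

lemma maximal_subgroup:
  assumes e: "e \<in> idempotents S"
  shows "e \<in> maximal_subgroup S e"
    and "g \<in> maximal_subgroup S e \<Longrightarrow> h \<in> maximal_subgroup S e \<Longrightarrow> g O h \<in> maximal_subgroup S e"
    and "g \<in> maximal_subgroup S e \<Longrightarrow> g\<inverse> \<in> maximal_subgroup S e"
    and "g \<in> maximal_subgroup S e \<Longrightarrow> e O g = g" and "g \<in> maximal_subgroup S e \<Longrightarrow> g O e = g"
    and "g \<in> maximal_subgroup S e \<Longrightarrow> g O g\<inverse> = e" and "g \<in> maximal_subgroup S e \<Longrightarrow> g\<inverse> O g = e"
    and "finite (maximal_subgroup S e)"
proof -
  have "Range e = Domain e" using idempotent_eq_Id_on[OF e] by (metis Range_Id_on)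
  then show "e \<in> maximal_subgroup S e" using maximal_subgroup_iff[OF e] idempotent_in[OF e] by simp
  show "g O h \<in> maximal_subgroup S e" if "g \<in> maximal_subgroup S e" "h \<in> maximal_subgroup S e"
    using that mult_closed unfolding maximal_subgroup_iff[OF e] by blast
  show "g\<inverse> \<in> maximal_subgroup S e" if "g \<in> maximal_subgroup S e"
    using that inverse_closed unfolding maximal_subgroup_iff[OF e] by auto
  show "e O g = g" "g O e = g" if "g \<in> maximal_subgroup S e"
    using that idempotent_mult[OF e, of g] unfolding maximal_subgroup_iff[OF e] by auto
  show "g O g\<inverse> = e" "g\<inverse> O g = e" if "g \<in> maximal_subgroup S e"
    using that by (auto simp: maximal_subgroup_def)
  show "finite (maximal_subgroup S e)"
    using finite_S by (simp add: maximal_subgroup_def)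
qed

lemma the_image:
  assumes "s \<in> S" "(i, j) \<in> s"
  shows "(THE j. (i, j) \<in> s) = j"
proof (rule the_equality)
  show "k = j" if "(i, k) \<in> s" for k
    using partial_permsD(1)[OF partial_perm[OF assms(1)] that assms(2)] .
qed (rule assms(2))

lemma maximal_subgroup_bij:
  assumes e: "e \<in> idempotents S" and g: "g \<in> maximal_subgroup S e"
  shows "bij_betw (\<lambda>i. THE j. (i, j) \<in> g) (Domain e) (Domain e)"
proof -
  have gS: "g \<in> S" and dom: "Domain g = Domain e" "Range g = Domain e"
    using g unfolding maximal_subgroup_iff[OF e] by blast+
  define f where "f i = (THE j. (i, j) \<in> g)" for i
  have f: "f i = j" if "(i, j) \<in> g" for i j
    using the_image[OF gS that] by (simp add: f_def)
  have graph: "(i, f i) \<in> g" if "i \<in> Domain e" for i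
  proof -
    obtain j where "(i, j) \<in> g" using \<open>i \<in> Domain e\<close> dom(1) by blast
    then show ?thesis using f by simp
  qed
  have "inj_on f (Domain e)"
    using graph partial_permsD(2)[OF partial_perm[OF gS]] by (intro inj_onI) metis
  moreover have "f ` Domain e = Domain e"
  proof
    show "f ` Domain e \<subseteq> Domain e" using graph dom(2) by blast
    show "Domain e \<subseteq> f ` Domain e"
    proof
      fix j assume "j \<in> Domain e"
      then obtain i where "(i, j) \<in> g" using dom(2) by blast
      moreover from this have "i \<in> Domain e" using dom(1) by blast
      ultimately show "j \<in> f ` Domain e" using f by (intro image_eqI[of _ _ i]) simp
    qed
  qed
  ultimately show ?thesis unfolding f_def by (rule bij_betw_imageI)
qed

lemma finite_Domain:
  assumes "s \<in> S"
  shows "finite (Domain s)"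
proof (rule finite_subset)
  show "Domain s \<subseteq> {..n}"
  proof
    fix x assume "x \<in> Domain s"
    then obtain y where "(x, y) \<in> s" by blast
    from partial_permsD(3)[OF partial_perm[OF assms] this] show "x \<in> {..n}" by simp
  qed
qed simp

text \<open>
  Composition on the right reverses the order of the underlying functions; this is harmless as signs
  commute.
\<close>

lemma sgn_at_mult:
  assumes e: "e \<in> idempotents S" and g: "g \<in> maximal_subgroup S e" and h: "h \<in> maximal_subgroup S e"
  shows "sgn_at e (g O h) = sgn_at e g * sgn_at e h"
proof -
  let ?f = "\<lambda>g i. THE j. (i, j) \<in> g"
  have S: "g \<in> S" "h \<in> S" and dom: "Domain g = Domain e" "Range g = Domain e" "Domain h = Domain e"
    using g h unfolding maximal_subgroup_iff[OF e] by blast+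
  have "?f (g O h) i = (?f h \<circ> ?f g) i" if "i \<in> Domain e" for i
  proof -
    obtain j where j: "(i, j) \<in> g" using \<open>i \<in> Domain e\<close> dom(1) by blast
    then have "j \<in> Domain h" using dom(2,3) by blast
    then obtain k where k: "(j, k) \<in> h" by blast
    have "?f (g O h) i = k"
      using the_image[OF mult_closed[OF S]] j k by blast
    then show ?thesis using the_image[OF S(1) j] the_image[OF S(2) k] by simp
  qed
  then have "sign_on (Domain e) (?f (g O h)) = sign_on (Domain e) (?f h \<circ> ?f g)"
    by (intro sign_on_cong refl)
  also have "\<dots> = sign_on (Domain e) (?f h) * sign_on (Domain e) (?f g)"
    using maximal_subgroup_bij[OF e g] maximal_subgroup_bij[OF e h] finite_Domain[OF idempotent_in[OF e]]
    by (intro sign_on_compose)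
  finally show ?thesis by (simp add: sgn_at_def mult.commute)
qed

lemma sgn_at_self:
  assumes e: "e \<in> idempotents S"
  shows "sgn_at e e = 1"
proof -
  have "(THE j. (i, j) \<in> e) = i" if "i \<in> Domain e" for i
  proof (rule the_image[OF idempotent_in[OF e]])
    show "(i, i) \<in> e" by (subst idempotent_eq_Id_on[OF e]) (rule Id_onI[OF that])
  qed
  then have "sign_on (Domain e) (\<lambda>i. THE j. (i, j) \<in> e) = sign_on (Domain e) (\<lambda>i. i)"
    by (intro sign_on_cong refl)
  then show ?thesis by (simp add: sgn_at_def)
qed

end

definition principal_minor :: "nat list \<Rightarrow> pperm \<Rightarrow> 'a::field" where
  "principal_minor xs s =
    det (mat (length xs) (length xs) (\<lambda>(i, j). if (Suc (xs ! i), Suc (xs ! j)) \<in> s then 1 else 0))"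

text \<open>
  The set of points of \<open>{1..n}\<close> that belongs to a list of matrix indices, which start at \<open>0\<close>.
\<close>

definition support :: "nat list \<Rightarrow> nat set" where
  "support xs = Suc ` set xs"

text \<open>
  Restricting \<open>s\<close> on the left to \<open>X\<close> keeps the rows of the rook matrix with index in \<open>X\<close> and clears the
  others.
\<close>

lemma principal_minor_restrict:
  "principal_minor xs (Id_on X O s) = (if support xs \<subseteq> X then principal_minor xs s else 0 :: 'a::field)"
proof (cases "support xs \<subseteq> X")
  case True
  have "(a, b) \<in> Id_on X O s \<longleftrightarrow> a \<in> X \<and> (a, b) \<in> s" for a b by auto
  then have "(Suc (xs ! i), Suc (xs ! j)) \<in> Id_on X O s \<longleftrightarrow> (Suc (xs ! i), Suc (xs ! j)) \<in> s"
    if "i < length xs" for i j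
    using True nth_mem[OF that] by (simp add: support_def image_subset_iff)
  then have "principal_minor xs (Id_on X O s) = (principal_minor xs s :: 'a)"
    unfolding principal_minor_def by (intro arg_cong[where f = det] eq_matI) auto
  with True show ?thesis by simp
next
  case False
  then obtain x where "x \<in> set xs" "Suc x \<notin> X" by (auto simp: support_def)
  then obtain i where i: "i < length xs" "Suc (xs ! i) \<notin> X" by (metis in_set_conv_nth)
  let ?p = "length xs"
  let ?A = "mat ?p ?p (\<lambda>(i, j). if (Suc (xs ! i), Suc (xs ! j)) \<in> Id_on X O s then 1 else 0) :: 'a mat"
  have "(\<Prod>a = 0..<?p. ?A $$ (a, \<pi> a)) = 0" if "\<pi> permutes {0..<?p}" for \<pi>
    using i permutes_in_image[OF that, of i] by (intro prod_zero bexI[of _ i]) auto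
  then have "det ?A = 0" by (subst det_def'[of _ ?p]) (simp, intro sum.neutral ballI, simp only: mem_Collect_eq mult_zero_right)
  with False show ?thesis by (simp add: principal_minor_def)
qed

text \<open>
  On its domain \<open>g\<close> is a permutation, so the principal minor is the determinant of a permutation matrix.
  The permutation \<open>\<pi>\<close> of the positions is that of the points transported along the enumeration \<open>y\<close>, which
  preserves the sign.
\<close>

lemma (in pperm_inverse_semigroup) principal_minor_maximal_subgroup:
  assumes e: "e \<in> idempotents S" and g: "g \<in> maximal_subgroup S e"
    and xs: "distinct xs" "support xs = Domain e"
  shows "principal_minor xs g = (sgn_at e g :: 'a::field)"
proof -
  let ?p = "length xs"
  let ?f = "\<lambda>i. THE j. (i, j) \<in> g"
  define y where "y i = Suc (xs ! i)" for i
  have y: "bij_betw y {0..<?p} (Domain e)"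
  proof -
    have "bij_betw ((!) xs) {0..<?p} (set xs)" using xs(1) by (intro bij_betw_nth) auto
    moreover have "bij_betw Suc (set xs) (Domain e)" using xs(2) by (auto simp: bij_betw_def support_def)
    ultimately show ?thesis using bij_betw_trans unfolding y_def comp_def by blast
  qed
  define \<pi> where "\<pi> = map_permutation (Domain e) (inv_into {0..<?p} y) (restrict_id ?f (Domain e))"
  have f: "restrict_id ?f (Domain e) permutes Domain e"
    using maximal_subgroup_bij[OF e g] by (rule permutes_restrict_id)
  have inv: "bij_betw (inv_into {0..<?p} y) (Domain e) {0..<?p}" using y by (rule bij_betw_inv_into)
  have \<pi>: "\<pi> permutes {0..<?p}" unfolding \<pi>_def by (rule map_permutation_permutes[OF inv f])
  have yinj: "inj_on y {0..<?p}" and yim: "y ` {0..<?p} = Domain e" using y by (auto simp: bij_betw_def)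
  have "finite (Domain e)" using bij_betw_finite[OF y] by simp
  have sgn: "sign \<pi> = sign_on (Domain e) ?f"
    unfolding \<pi>_def sign_on_def
    using inv f \<open>finite (Domain e)\<close> by (intro sign_map_permutation) (auto simp: bij_betw_def)
  have gS: "g \<in> S" and dom: "Domain g = Domain e" "Range g = Domain e"
    using g maximal_subgroup_iff[OF e] by auto
  have entry: "(y i, y j) \<in> g \<longleftrightarrow> j = \<pi> i" if "i < ?p" "j < ?p" for i j
  proof -
    have yi: "y i \<in> Domain e" using that yim by auto
    have "inv_into {0..<?p} y (y i) = i" using that yinj by simp
    then have "\<pi> i = inv_into {0..<?p} y (?f (y i))"
      unfolding \<pi>_def using map_permutation_apply[of "inv_into {0..<?p} y" "Domain e" "y i"] inv yi
      by (simp add: bij_betw_def restrict_id_def)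
    moreover have "?f (y i) \<in> y ` {0..<?p}"
      unfolding yim using bij_betwE[OF maximal_subgroup_bij[OF e g]] yi by (rule bspec)
    ultimately have "y (\<pi> i) = ?f (y i)" by (simp add: f_inv_into_f)
    moreover have "\<pi> i < ?p" using permutes_in_image[OF \<pi>, of i] that by simp
    moreover have "(y i, y j) \<in> g \<longleftrightarrow> y j = ?f (y i)"
      using the_image[OF gS] yi dom(1) by (metis DomainE)
    ultimately show ?thesis using that inj_on_eq_iff[OF yinj, of j "\<pi> i"] by auto
  qed
  let ?A = "mat ?p ?p (\<lambda>(i, j). if (y i, y j) \<in> g then 1 else 0) :: 'a mat"
  have "det ?A = (\<Sum>\<tau> | \<tau> permutes {0..<?p}. if \<tau> = \<pi> then signof \<pi> else 0)"
  proof (subst det_def'[of _ ?p], simp, intro sum.cong refl)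
    fix \<tau> assume "\<tau> \<in> {\<tau>. \<tau> permutes {0..<?p}}"
    then have \<tau>: "\<tau> permutes {0..<?p}" by simp
    have lt: "\<tau> i < ?p" if "i < ?p" for i using permutes_in_image[OF \<tau>, of i] that by simp
    have "(\<Prod>i = 0..<?p. ?A $$ (i, \<tau> i)) = (\<Prod>i = 0..<?p. if \<tau> i = \<pi> i then 1 else 0)"
      using lt by (intro prod.cong refl) (auto simp: entry)
    also have "\<dots> = (if \<tau> = \<pi> then 1 else 0)"
    proof (cases "\<tau> = \<pi>")
      case False
      then obtain i where "\<tau> i \<noteq> \<pi> i" by auto
      then have "i \<in> {0..<?p}" using permutes_not_in[OF \<pi>] permutes_not_in[OF \<tau>] by metis
      then have "(\<Prod>i = 0..<?p. if \<tau> i = \<pi> i then 1 else 0 :: 'a) = 0"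
        using \<open>\<tau> i \<noteq> \<pi> i\<close> by (intro prod_zero bexI[of _ i]) auto
      with False show ?thesis by simp
    qed simp
    finally show "signof \<tau> * (\<Prod>i = 0..<?p. ?A $$ (i, \<tau> i)) = (if \<tau> = \<pi> then signof \<pi> else 0)" by simp
  qed
  also have "\<dots> = signof \<pi>"
    using \<pi> finite_permutations[of "{0..<?p}"] by simp
  finally show ?thesis by (simp add: principal_minor_def y_def sgn_at_def sgn)
qed

section \<open>Moebius sums of the exterior character\<close>

lemma index_list_of_set:
  assumes "X \<subseteq> {1..n}" "card X = p"
  obtains xs where "xs \<in> set (index_lists n p)" "support xs = X"
proof -
  define Y where "Y = {i. Suc i \<in> X}"
  have SucY: "Suc ` Y = X"
  proof
    show "Suc ` Y \<subseteq> X" by (auto simp: Y_def)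
    show "X \<subseteq> Suc ` Y"
    proof
      fix x assume "x \<in> X"
      moreover from this have "x = Suc (x - 1)" using assms(1) by auto
      ultimately show "x \<in> Suc ` Y" unfolding Y_def by (intro image_eqI[of _ _ "x - 1"]) auto
    qed
  qed
  have "finite X" using assms(1) finite_subset by blast
  then have Y: "finite Y" "card Y = p" "Y \<subseteq> {..<n}"
    using SucY assms card_image[of Suc Y] finite_imageD[of Suc Y] by auto
  show thesis
    by (rule that[of "sorted_list_of_set Y"]) (use Y SucY in \<open>auto simp: set_index_lists support_def\<close>)
qed

lemma support_index_list:
  assumes "xs \<in> set (index_lists n p)"
  shows "support xs \<subseteq> {1..n}" "card (support xs) = p" "distinct xs"
proof -
  have xs: "sorted_wrt (<) xs" "length xs = p" "set xs \<subseteq> {..<n}" using assms by (auto simp: set_index_lists)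
  then show "distinct xs" by (simp add: strict_sorted_iff)
  then show "card (support xs) = p" using xs by (simp add: support_def card_image distinct_card)
  show "support xs \<subseteq> {1..n}" using xs by (auto simp: support_def)
qed

lemma support_subset_imp_eq:
  assumes "xs \<in> set (index_lists n p)" "ys \<in> set (index_lists n p)" "support ys \<subseteq> support xs"
  shows "xs = ys"
  using assms by (intro increasing_lists_eqI) (auto simp: set_index_lists support_def)

locale contains_rank = pperm_inverse_semigroup +
  fixes p :: nat
  assumes p_le_n: "p \<le> n"
    and contains_rank: "{e \<in> idempotents (partial_perms n). rk e = p} \<subseteq> S"
begin

lemma support_idempotent:
  assumes "xs \<in> set (index_lists n p)"
  shows "Id_on (support xs) \<in> idempotents S" "rk (Id_on (support xs)) = p"
proof -
  show rk: "rk (Id_on (support xs)) = p" using support_index_list[OF assms] by (simp add: rk_def)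
  have "Id_on (support xs) \<in> idempotents (partial_perms n)"
    using Id_on_partial_perms[of "support xs" n] support_index_list[OF assms]
    by (auto simp: idempotents_def)
  then show "Id_on (support xs) \<in> idempotents S"
    using rk contains_rank by (intro Id_on_idempotent) auto
qed

lemma idempotent_support:
  assumes "e \<in> idempotents S" "rk e = p"
  obtains xs where "xs \<in> set (index_lists n p)" "e = Id_on (support xs)"
proof -
  have e: "e = Id_on (Domain e)" by (rule idempotent_eq_Id_on[OF assms(1)])
  then have "Range e = Domain e" by (metis Range_Id_on)
  moreover have "Domain e \<subseteq> {1..n}"
    using partial_perm[OF idempotent_in[OF assms(1)]] by (auto simp: partial_perms_def)
  ultimately obtain xs where "xs \<in> set (index_lists n p)" "support xs = Domain e"
    using assms(2) index_list_of_set[of "Domain e" n p] unfolding rk_def by metis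
  then show thesis using that e by simp
qed

definition exterior_character :: "pperm \<Rightarrow> 'a::field" where
  "exterior_character s = (\<Sum>xs\<in>set (index_lists n p). principal_minor xs s)"

text \<open>
  A principal minor of \<open>f g\<close> is the corresponding minor of \<open>g\<close> if the
  support \<open>X\<close> of the minor is contained in \<open>f\<close>, and zero otherwise. So for each \<open>X\<close> the minor of \<open>g\<close> is multiplied by
  the sum of \<open>\<mu>(f, e)\<close> over the idempotents \<open>f\<close> between \<open>1\<^sub>X\<close> and \<open>e\<close>. As \<open>X\<close> has \<open>p\<close> elements, \<open>1\<^sub>X\<close> is itself
  an idempotent of \<open>S\<close>, and that sum is \<open>1\<close> if \<open>1\<^sub>X = e\<close> and \<open>0\<close> otherwise. The only minor that survives has
  the domain of \<open>e\<close> as support, and it equals the sign of \<open>g\<close>.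
\<close>

lemma moebius_sum_exterior_character:
  assumes e: "e \<in> idempotents S" and g: "g \<in> maximal_subgroup S e"
  shows "(\<Sum>f\<in>{f \<in> idempotents S. f \<subseteq> e}. of_int (moebius (idempotents S) f e) * exterior_character (f O g))
    = (if rk e = p then sgn_at e g else 0 :: 'a::field)"
proof -
  let ?E = "idempotents S" and ?L = "set (index_lists n p)"
  let ?D = "{f \<in> ?E. f \<subseteq> e}"
  let ?m = "\<lambda>f. of_int (moebius ?E f e) :: 'a"
  let ?I = "\<lambda>xs. Id_on (support xs)"
  have minor: "principal_minor xs (f O g) = (if ?I xs \<subseteq> f then principal_minor xs g else 0 :: 'a)"
    if f: "f \<in> ?E" for f xs
  proof -
    obtain X where "f = Id_on X" using idempotent_eq_Id_on[OF f] by metis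
    moreover have "Id_on Y \<subseteq> Id_on X \<longleftrightarrow> Y \<subseteq> X" for Y :: "nat set" by auto
    ultimately show ?thesis by (simp add: principal_minor_restrict)
  qed
  have "(\<Sum>f\<in>?D. ?m f * exterior_character (f O g))
      = (\<Sum>f\<in>?D. \<Sum>xs\<in>?L. if ?I xs \<subseteq> f then ?m f * principal_minor xs g else 0)"
    unfolding exterior_character_def sum_distrib_left
    by (intro sum.cong refl) (simp add: minor)
  also have "\<dots> = (\<Sum>xs\<in>?L. \<Sum>f\<in>?D. if ?I xs \<subseteq> f then ?m f * principal_minor xs g else 0)"
    by (rule sum.swap)
  also have "\<dots> = (\<Sum>xs\<in>?L. if ?I xs = e then sgn_at e g else 0)"
  proof (intro sum.cong refl)
    fix xs assume xs: "xs \<in> ?L"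
    have "(\<Sum>f\<in>?D. if ?I xs \<subseteq> f then ?m f * principal_minor xs g else 0)
        = (\<Sum>f\<in>{f \<in> ?E. ?I xs \<subseteq> f \<and> f \<subseteq> e}. ?m f * principal_minor xs g)"
      by (rule sum.mono_neutral_cong_right) (use finite_idempotents in auto)
    also have "\<dots> = of_int (\<Sum>f\<in>{f \<in> ?E. ?I xs \<subseteq> f \<and> f \<subseteq> e}. moebius ?E f e) * principal_minor xs g"
      by (simp add: sum_distrib_right)
    also have "\<dots> = (if ?I xs = e then sgn_at e g else 0)"
    proof (cases "?I xs \<subseteq> e")
      case True
      have "principal_minor xs g = (sgn_at e g :: 'a)" if "?I xs = e"
        using principal_minor_maximal_subgroup[OF e g] support_index_list[OF xs] that
        by (metis Domain_Id_on)
      then show ?thesis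
        using sum_moebius_lower[OF finite_idempotents support_idempotent(1)[OF xs] e True] by simp
    next
      case False
      then have "principal_minor xs g = (0 :: 'a)"
        using minor[OF e] maximal_subgroup(4)[OF e g] by metis
      with False show ?thesis by auto
    qed
    finally show "(\<Sum>f\<in>?D. if ?I xs \<subseteq> f then ?m f * principal_minor xs g else 0)
        = (if ?I xs = e then sgn_at e g else 0)" .
  qed
  also have "\<dots> = (if rk e = p then sgn_at e g else 0)"
  proof (cases "rk e = p")
    case True
    then obtain ys where ys: "ys \<in> ?L" "e = ?I ys" using idempotent_support[OF e] by blast
    have "?I xs = e \<longleftrightarrow> xs = ys" if "xs \<in> ?L" for xs
    proof
      assume "?I xs = e"
      then have "support xs = support ys" using ys(2) by (metis Domain_Id_on)
      then show "xs = ys" using support_subset_imp_eq[OF that ys(1)] by simp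
    qed (use ys in simp)
    then have "(\<Sum>xs\<in>?L. if ?I xs = e then sgn_at e g else 0 :: 'a)
        = (\<Sum>xs\<in>?L. if xs = ys then sgn_at e g else 0)" by (intro sum.cong refl) auto
    with True ys show ?thesis by simp
  next
    case False
    then have "?I xs \<noteq> e" if "xs \<in> ?L" for xs using support_idempotent(2)[OF that] by blast
    with False show ?thesis by simp
  qed
  finally show ?thesis .
qed

lemma character_rook_exterior_power:
  assumes \<rho>: "exterior_power_rep S n (rook_mat n) p d \<rho>" and s: "s \<in> S"
  shows "character \<rho> s = exterior_character s"
proof -
  have "character \<rho> s = (\<Sum>xs\<in>set (index_lists n p). det (mat p p (\<lambda>(i, j). rook_mat n s $$ (xs ! i, xs ! j))))"
    by (rule character_exterior_power[OF \<rho> s]) (simp add: rook_mat_def)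
  also have "\<dots> = exterior_character s"
    unfolding exterior_character_def
  proof (intro sum.cong refl)
    fix xs assume "xs \<in> set (index_lists n p)"
    then have xs: "length xs = p" "\<And>i. i < p \<Longrightarrow> xs ! i < n" by (auto simp: set_index_lists subset_iff)
    show "det (mat p p (\<lambda>(i, j). rook_mat n s $$ (xs ! i, xs ! j))) = principal_minor xs s"
      unfolding principal_minor_def xs(1)
      by (intro arg_cong[where f = det] eq_matI) (auto simp: rook_mat_def xs)
  qed
  finally show ?thesis .
qed

end

section \<open>Linear characters of maximal subgroups\<close>

lemma subspace_vec_iff:
  "subspace class_ring W (module_vec TYPE('a::field) d) \<longleftrightarrow>
    W \<subseteq> carrier_vec d \<and> 0\<^sub>v d \<in> W \<and> (\<forall>u\<in>W. \<forall>v\<in>W. u + v \<in> W) \<and> (\<forall>c. \<forall>v\<in>W. c \<cdot>\<^sub>v v \<in> W)"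
  using vec_vs[of d, where 'a = 'a] vec_module[of d, where 'a = 'a]
  by (auto simp: subspace_def submodule_def module_vec_simps class_ring_simps)

text \<open>
  A linear combination, given by its coordinates: vectors of all dimensions share one type, which is not
  an additive monoid, so that \<^const>\<open>sum\<close> does not apply to them.
\<close>

definition vec_sum :: "nat \<Rightarrow> 'b set \<Rightarrow> ('b \<Rightarrow> 'a) \<Rightarrow> ('b \<Rightarrow> 'a::field vec) \<Rightarrow> 'a vec" where
  "vec_sum d A c v = vec d (\<lambda>i. \<Sum>a\<in>A. c a * v a $ i)"

lemma vec_sum_carrier [simp]: "vec_sum d A c v \<in> carrier_vec d" "dim_vec (vec_sum d A c v) = d"
  and vec_sum_index [simp]: "i < d \<Longrightarrow> vec_sum d A c v $ i = (\<Sum>a\<in>A. c a * v a $ i)"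
  by (simp_all add: vec_sum_def)

lemma vec_sum_in_subspace:
  assumes W: "subspace class_ring W (module_vec TYPE('a::field) d)" and "finite A"
    and "\<And>a. a \<in> A \<Longrightarrow> v a \<in> W"
  shows "vec_sum d A c v \<in> W"
  using assms(2,3)
proof (induction A rule: finite_induct)
  case empty
  have "vec_sum d {} c v = 0\<^sub>v d" by (intro eq_vecI) auto
  then show ?case using W by (simp add: subspace_vec_iff)
next
  case (insert a A)
  then have "v a \<in> carrier_vec d" using W by (auto simp: subspace_vec_iff)
  then have "vec_sum d (insert a A) c v = c a \<cdot>\<^sub>v v a + vec_sum d A c v"
    using insert.hyps by (intro eq_vecI) auto
  then show ?case using insert W by (simp add: subspace_vec_iff)
qed

lemma mult_mat_vec_sum:
  assumes "M \<in> carrier_mat m d" "\<And>a. a \<in> A \<Longrightarrow> v a \<in> carrier_vec d"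
  shows "M *\<^sub>v vec_sum d A c v = vec_sum m A c (\<lambda>a. M *\<^sub>v v a)"
proof (rule eq_vecI)
  fix i assume "i < dim_vec (vec_sum m A c (\<lambda>a. M *\<^sub>v v a))"
  then have i: "i < m" by simp
  have "(M *\<^sub>v vec_sum d A c v) $ i = (\<Sum>j<d. \<Sum>a\<in>A. M $$ (i, j) * (c a * v a $ j))"
    using assms i by (simp add: scalar_prod_def atLeast0LessThan sum_distrib_left)
  also have "\<dots> = (\<Sum>a\<in>A. \<Sum>j<d. M $$ (i, j) * (c a * v a $ j))" by (rule sum.swap)
  also have "\<dots> = (\<Sum>a\<in>A. c a * (M *\<^sub>v v a) $ i)"
  proof (intro sum.cong refl)
    fix a assume "a \<in> A"
    then show "(\<Sum>j<d. M $$ (i, j) * (c a * v a $ j)) = c a * (M *\<^sub>v v a) $ i"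
      using assms(1) assms(2)[of a] i
      by (simp add: scalar_prod_def atLeast0LessThan sum_distrib_left mult.left_commute)
  qed
  finally show "(M *\<^sub>v vec_sum d A c v) $ i = vec_sum m A c (\<lambda>a. M *\<^sub>v v a) $ i"
    using i by simp
qed (use assms in simp)

text \<open>
  The space \<open>W\<close> of vectors on which the group acts through \<open>lam\<close> is invariant. If it is everything, then
  every subspace is invariant, so the degree is \<open>1\<close> and \<open>\<chi> = lam\<close>. If it is zero, then so is the operator
  \<open>\<Sum>g. lam g \<rho>(g\<inverse>)\<close>, whose image lies in \<open>W\<close>. Its trace is the sum in question, and \<open>\<chi> = lam\<close> is excluded
  because the sum would then be the order of the group.
\<close>

lemma (in pperm_inverse_semigroup) linear_character_orthogonality:
  fixes \<chi> lam :: "pperm \<Rightarrow> 'a::field_char_0"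
  assumes e: "e \<in> idempotents S" and \<chi>: "\<chi> \<in> Irr (maximal_subgroup S e)"
    and lam_mult: "\<And>g h. g \<in> maximal_subgroup S e \<Longrightarrow> h \<in> maximal_subgroup S e \<Longrightarrow>
      lam (g O h) = lam g * lam h"
    and lam_one: "lam e = 1"
  shows "(\<Sum>g\<in>maximal_subgroup S e. \<chi> (g\<inverse>) * lam g)
    = (if \<forall>g\<in>maximal_subgroup S e. \<chi> g = lam g then of_nat (card (maximal_subgroup S e)) else 0)"
proof -
  let ?G = "maximal_subgroup S e"
  note G = maximal_subgroup[OF e]
  obtain d \<rho> where irr: "irreducible_rep ?G d \<rho>" and \<chi>\<rho>: "\<And>g. g \<in> ?G \<Longrightarrow> \<chi> g = character \<rho> g"
    using \<chi> unfolding Irr_def by blast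
  have \<rho>: "\<rho> g \<in> carrier_mat d d" if "g \<in> ?G" for g
    using irr that by (simp add: irreducible_rep_def representation_def)
  have \<rho>_mult: "\<rho> (g O h) = \<rho> g * \<rho> h" if "g \<in> ?G" "h \<in> ?G" for g h
    using irr that by (simp add: irreducible_rep_def representation_def)
  have invariant: "W = {0\<^sub>v d} \<or> W = carrier_vec d"
    if "subspace class_ring W (module_vec TYPE('a) d)" "\<And>g v. g \<in> ?G \<Longrightarrow> v \<in> W \<Longrightarrow> \<rho> g *\<^sub>v v \<in> W" for W
    using irr that unfolding irreducible_rep_def by blast
  have lam_inv: "lam (g\<inverse>) * lam g = 1" if "g \<in> ?G" for g
    using lam_mult[OF G(3)[OF that] that] G(7)[OF that] lam_one by simp
  have full: "(\<Sum>g\<in>?G. lam (g\<inverse>) * lam g) = of_nat (card ?G)"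
    using lam_inv by simp
  have card: "of_nat (card ?G) \<noteq> (0 :: 'a)" using G(1,8) by auto
  define W where "W = {v \<in> carrier_vec d. \<forall>g\<in>?G. \<rho> g *\<^sub>v v = lam g \<cdot>\<^sub>v v}"
  have W: "subspace class_ring W (module_vec TYPE('a) d)"
    unfolding subspace_vec_iff
  proof (intro conjI ballI allI)
    have "\<rho> g *\<^sub>v 0\<^sub>v d = lam g \<cdot>\<^sub>v 0\<^sub>v d" if "g \<in> ?G" for g
      using \<rho>[OF that] by (intro eq_vecI) auto
    then show "0\<^sub>v d \<in> W" by (simp add: W_def)
    show "u + v \<in> W" if "u \<in> W" "v \<in> W" for u v
      using that mult_add_distrib_mat_vec[OF \<rho>] by (auto simp: W_def smult_add_distrib_vec)
    show "c \<cdot>\<^sub>v v \<in> W" if "v \<in> W" for c v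
      using that mult_mat_vec[OF \<rho>] by (auto simp: W_def smult_smult_assoc mult.commute)
  qed (auto simp: W_def)
  have "\<rho> g *\<^sub>v v \<in> W" if "g \<in> ?G" "v \<in> W" for g v
  proof -
    have "\<rho> g *\<^sub>v v = lam g \<cdot>\<^sub>v v" using that by (simp add: W_def)
    then show ?thesis using W that(2) by (simp add: subspace_vec_iff)
  qed
  from invariant[OF W this] show ?thesis
  proof
    assume W0: "W = {0\<^sub>v d}"
    define P where "P v = vec_sum d ?G lam (\<lambda>g. \<rho> (g\<inverse>) *\<^sub>v v)" for v
    have P0: "P v = 0\<^sub>v d" if v: "v \<in> carrier_vec d" for v
    proof -
      have "\<rho> h *\<^sub>v P v = lam h \<cdot>\<^sub>v P v" if h: "h \<in> ?G" for h
      proof -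
        have bij: "bij_betw (\<lambda>g. g O h) ?G ?G"
          by (rule bij_betwI[where g = "\<lambda>g. g O h\<inverse>"]) (use G h in \<open>auto simp: O_assoc\<close>)
        have "\<rho> h *\<^sub>v P v = vec_sum d ?G lam (\<lambda>g. \<rho> h *\<^sub>v (\<rho> (g\<inverse>) *\<^sub>v v))"
          unfolding P_def using \<rho>[OF h] mult_mat_vec_carrier[OF \<rho>[OF G(3)] v]
          by (intro mult_mat_vec_sum)
        also have "\<dots> = lam h \<cdot>\<^sub>v P v"
        proof (rule eq_vecI)
          fix i assume "i < dim_vec (lam h \<cdot>\<^sub>v P v)"
          then have i: "i < d" by (simp add: P_def)
          have "vec_sum d ?G lam (\<lambda>g. \<rho> h *\<^sub>v (\<rho> (g\<inverse>) *\<^sub>v v)) $ i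
              = (\<Sum>g\<in>?G. lam g * (\<rho> h *\<^sub>v (\<rho> (g\<inverse>) *\<^sub>v v)) $ i)" using i by simp
          also have "\<dots> = (\<Sum>g\<in>?G. lam (g O h) * (\<rho> h *\<^sub>v (\<rho> ((g O h)\<inverse>) *\<^sub>v v)) $ i)"
            by (rule sum.reindex_bij_betw[OF bij, symmetric])
          also have "\<dots> = (\<Sum>g\<in>?G. lam h * (lam g * (\<rho> (g\<inverse>) *\<^sub>v v) $ i))"
          proof (intro sum.cong refl)
            fix g assume g: "g \<in> ?G"
            have "h O (g O h)\<inverse> = g\<inverse>"
              using G(6)[OF h] G(4)[OF G(3)[OF g]] by (simp add: converse_relcomp O_assoc[symmetric])
            then have "\<rho> h *\<^sub>v (\<rho> ((g O h)\<inverse>) *\<^sub>v v) = \<rho> (g\<inverse>) *\<^sub>v v"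
              using \<rho>_mult[OF h G(3)[OF G(2)[OF g h]]]
                assoc_mult_mat_vec[OF \<rho>[OF h] \<rho>[OF G(3)[OF G(2)[OF g h]]] v] by simp
            then show "lam (g O h) * (\<rho> h *\<^sub>v (\<rho> ((g O h)\<inverse>) *\<^sub>v v)) $ i
                = lam h * (lam g * (\<rho> (g\<inverse>) *\<^sub>v v) $ i)"
              using lam_mult[OF g h] by simp
          qed
          also have "\<dots> = (lam h \<cdot>\<^sub>v P v) $ i" using i by (simp add: P_def sum_distrib_left)
          finally show "vec_sum d ?G lam (\<lambda>g. \<rho> h *\<^sub>v (\<rho> (g\<inverse>) *\<^sub>v v)) $ i = (lam h \<cdot>\<^sub>v P v) $ i" .
        qed (simp add: P_def)
        finally show ?thesis .
      qed
      then have "P v \<in> W" by (simp add: W_def P_def)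
      then show ?thesis using W0 by simp
    qed
    have "(\<Sum>g\<in>?G. \<chi> (g\<inverse>) * lam g) = (\<Sum>g\<in>?G. \<Sum>j<d. lam g * \<rho> (g\<inverse>) $$ (j, j))"
    proof (intro sum.cong refl)
      fix g assume "g \<in> ?G"
      then have "g\<inverse> \<in> ?G" by (rule G(3))
      then show "\<chi> (g\<inverse>) * lam g = (\<Sum>j<d. lam g * \<rho> (g\<inverse>) $$ (j, j))"
        using \<chi>\<rho>[of "g\<inverse>"] \<rho>[of "g\<inverse>"] by (simp add: character_def sum_distrib_left mult.commute)
    qed
    also have "\<dots> = (\<Sum>j<d. \<Sum>g\<in>?G. lam g * \<rho> (g\<inverse>) $$ (j, j))" by (rule sum.swap)
    also have "\<dots> = (\<Sum>j<d. P (unit_vec d j) $ j)"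
    proof (intro sum.cong refl)
      fix j assume "j \<in> {..<d}"
      then have "(\<rho> (g\<inverse>) *\<^sub>v unit_vec d j) $ j = \<rho> (g\<inverse>) $$ (j, j)" if "g \<in> ?G" for g
        using carrier_matD[OF \<rho>[OF G(3)[OF that]]] mat_mult_unit_vec[OF \<rho>[OF G(3)[OF that]], of j] by simp
      then show "(\<Sum>g\<in>?G. lam g * \<rho> (g\<inverse>) $$ (j, j)) = P (unit_vec d j) $ j"
        using \<open>j \<in> {..<d}\<close> by (simp add: P_def)
    qed
    also have "\<dots> = 0" by (simp add: P0)
    finally have *: "(\<Sum>g\<in>?G. \<chi> (g\<inverse>) * lam g) = 0" .
    have "\<not> (\<forall>g\<in>?G. \<chi> g = lam g)"
    proof
      assume eq: "\<forall>g\<in>?G. \<chi> g = lam g"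
      have "(\<Sum>g\<in>?G. \<chi> (g\<inverse>) * lam g) = (\<Sum>g\<in>?G. lam (g\<inverse>) * lam g)"
        using eq G(3) by (intro sum.cong refl) simp
      then show False using * full card by simp
    qed
    with * show ?thesis by (simp only: if_False)
  next
    assume "W = carrier_vec d"
    then have scalar: "\<rho> g *\<^sub>v v = lam g \<cdot>\<^sub>v v" if "g \<in> ?G" "v \<in> carrier_vec d" for g v
      using that by (auto simp: W_def)
    obtain s where s: "s \<in> ?G" "\<rho> s \<noteq> 0\<^sub>m d d" using irr by (auto simp: irreducible_rep_def)
    have "d \<noteq> 0"
    proof
      assume "d = 0"
      then have "\<rho> s = 0\<^sub>m d d" using \<rho>[OF s(1)] by (intro eq_matI) auto
      then show False using s(2) by simp
    qed
    \<comment> \<open>Now every subspace is invariant, in particular a line; so the degree is \<open>1\<close>.\<close>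
    define U where "U = {v \<in> carrier_vec d. \<forall>i<d. i \<noteq> 0 \<longrightarrow> v $ i = (0 :: 'a)}"
    have U: "subspace class_ring U (module_vec TYPE('a) d)"
      unfolding subspace_vec_iff by (auto simp: U_def)
    have "\<rho> g *\<^sub>v v \<in> U" if "g \<in> ?G" "v \<in> U" for g v
    proof -
      have "\<rho> g *\<^sub>v v = lam g \<cdot>\<^sub>v v" using that scalar by (simp add: U_def)
      then show ?thesis using U that(2) by (simp add: subspace_vec_iff)
    qed
    from invariant[OF U this] have "d = 1"
    proof
      assume "U = {0\<^sub>v d}"
      moreover have "unit_vec d 0 \<in> U" using \<open>d \<noteq> 0\<close> by (simp add: U_def)
      ultimately show "d = 1" using \<open>d \<noteq> 0\<close> unit_vec_nonzero[of d 0, where 'a = 'a] by simp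
    next
      assume "U = carrier_vec d"
      then have "unit_vec d 1 \<in> U" by simp
      then have "\<not> 1 < d" by (auto simp: U_def)
      then show "d = 1" using \<open>d \<noteq> 0\<close> by simp
    qed
    have eq: "\<chi> g = lam g" if g: "g \<in> ?G" for g
    proof -
      have "\<chi> g = (\<rho> g *\<^sub>v unit_vec d 0) $ 0"
        using \<chi>\<rho>[OF g] \<rho>[OF g] \<open>d = 1\<close> by (simp add: character_def mat_mult_unit_vec[of _ d d])
      also have "\<dots> = lam g" using scalar[OF g, of "unit_vec d 0"] \<open>d = 1\<close> by simp
      finally show ?thesis .
    qed
    have "(\<Sum>g\<in>?G. \<chi> (g\<inverse>) * lam g) = (\<Sum>g\<in>?G. lam (g\<inverse>) * lam g)"
      using eq G(3) by (intro sum.cong refl) simp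
    then show ?thesis using eq full by simp
  qed
qed

section \<open>Characters separating nonisomorphic idempotents\<close>

context pperm_inverse_semigroup
begin

text \<open>
  For \<open>F\<close> the coordinates of a representation, this says that the elements \<open>\<epsilon>\<^sub>e = \<Sum>f\<le>e. \<mu>(f, e) f\<close> of the
  semigroup algebra satisfy \<open>\<epsilon>\<^sub>e s \<epsilon>\<^sub>e\<^sub>' = 0\<close> unless \<open>e\<close> and \<open>e'\<close> are isomorphic. Here \<open>s\<close> may be replaced
  by \<open>t = e s e'\<close>. If \<open>t t\<inverse> = e\<close> and \<open>t\<inverse> t = e'\<close>, then \<open>t\<close> is an isomorphism. Otherwise, one of these
  idempotents is not above \<open>e\<close> or \<open>e'\<close> respectively, and since \<open>(t t\<inverse>) t = t = t (t\<inverse> t)\<close> it may be inserted next to \<open>t\<close>,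
  where it annihilates \<open>\<epsilon>\<^sub>e\<close> or \<open>\<epsilon>\<^sub>e\<^sub>'\<close> by Weisner's theorem.
\<close>

lemma moebius_sums_separate:
  fixes F :: "pperm \<Rightarrow> 'a::comm_ring_1"
  assumes e: "e \<in> idempotents S" and e': "e' \<in> idempotents S" and s: "s \<in> S"
    and not_iso: "\<not> isomorphic_idempotents S e e'"
  shows "(\<Sum>f\<in>{f \<in> idempotents S. f \<subseteq> e}. \<Sum>f'\<in>{f' \<in> idempotents S. f' \<subseteq> e'}.
    of_int (moebius (idempotents S) f e) * of_int (moebius (idempotents S) f' e') * F (f O s O f')) = 0"
proof -
  let ?E = "idempotents S"
  let ?m = "\<lambda>f e. of_int (moebius ?E f e) :: 'a"
  define t where "t = e O s O e'"
  have t: "t \<in> S" using e e' s mult_closed idempotent_in by (simp add: t_def)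
  note tt = inverse_mult(3,4)[OF t]
  have ft: "F (f O s O f') = F (f O t O f')" if "f \<in> ?E" "f \<subseteq> e" "f' \<in> ?E" "f' \<subseteq> e'" for f f'
  proof -
    have "f O e = f" "e' O f' = f'"
      using idempotents_inter(1)[OF that(1) e] idempotents_inter(1)[OF e' that(3)] that by auto
    then have "f O t O f' = f O s O f'" unfolding t_def by (metis O_assoc)
    then show ?thesis by simp
  qed
  have inter: "\<And>x y. x \<in> ?E \<Longrightarrow> y \<in> ?E \<Longrightarrow> inf x y \<in> ?E" using idempotents_inter(2) by blast
  have "\<not> e \<subseteq> t O t\<inverse> \<or> \<not> e' \<subseteq> t\<inverse> O t"
  proof (rule ccontr)
    assume *: "\<not> ?thesis"
    have "e O t = t" "t O e' = t"
      using idempotents_inter(1)[OF e e] idempotents_inter(1)[OF e' e'] unfolding t_def by (metis O_assoc Int_absorb)+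
    then have "Domain t \<subseteq> Domain e" "Range t \<subseteq> Range e'" by blast+
    moreover have "Range e' = Domain e'" using idempotent_eq_Id_on[OF e'] by (metis Range_Id_on)
    ultimately have "Id_on (Domain t) \<subseteq> Id_on (Domain e)" "Id_on (Range t) \<subseteq> Id_on (Domain e')"
      by auto
    then have "t O t\<inverse> \<subseteq> e" "t\<inverse> O t \<subseteq> e'"
      by (simp_all only: inverse_mult(1,2)[OF t] idempotent_eq_Id_on[OF e, symmetric]
        idempotent_eq_Id_on[OF e', symmetric])
    with * have "t O t\<inverse> = e" "t\<inverse> O t = e'" by auto
    with not_iso t show False unfolding isomorphic_idempotents_def by blast
  qed
  then have "(\<Sum>f\<in>{f \<in> ?E. f \<subseteq> e}. \<Sum>f'\<in>{f' \<in> ?E. f' \<subseteq> e'}. ?m f e * ?m f' e' * F (f O t O f')) = 0"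
  proof
    assume ne: "\<not> e \<subseteq> t O t\<inverse>"
    have "(t O t\<inverse>) O t = t" unfolding inverse_mult(1)[OF t] by auto
    then have eq: "F (f O t O f') = F (inf f (t O t\<inverse>) O t O f')" if "f \<in> ?E" for f f'
      using idempotents_inter(1)[OF that tt(1)] by (metis O_assoc)
    have "(\<Sum>f\<in>{f \<in> ?E. f \<le> e}. ?m f e * F (inf f (t O t\<inverse>) O t O f')) = 0" for f'
      by (rule weisner[OF finite_idempotents inter e tt(1) ne])
    then have "(\<Sum>f\<in>{f \<in> ?E. f \<subseteq> e}. ?m f' e' * (?m f e * F (f O t O f'))) = 0" for f'
      unfolding sum_distrib_left[symmetric] using eq by simp
    then show ?thesis by (subst sum.swap) (simp add: mult_ac)
  next
    assume ne: "\<not> e' \<subseteq> t\<inverse> O t"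
    have "t O (t\<inverse> O t) = t" unfolding inverse_mult(2)[OF t] by auto
    then have eq: "F (f O t O f') = F (f O t O inf f' (t\<inverse> O t))" if "f' \<in> ?E" for f f'
      using idempotents_inter(1)[OF tt(2) that] by (metis O_assoc Int_commute)
    have "(\<Sum>f'\<in>{f' \<in> ?E. f' \<le> e'}. ?m f' e' * F (f O t O inf f' (t\<inverse> O t))) = 0" for f
      by (rule weisner[OF finite_idempotents inter e' tt(2) ne])
    then have "(\<Sum>f'\<in>{f' \<in> ?E. f' \<subseteq> e'}. ?m f e * (?m f' e' * F (f O t O f'))) = 0" for f
      unfolding sum_distrib_left[symmetric] using eq by simp
    then show ?thesis by (simp add: mult_ac)
  qed
  moreover have "(\<Sum>f\<in>{f \<in> ?E. f \<subseteq> e}. \<Sum>f'\<in>{f' \<in> ?E. f' \<subseteq> e'}. ?m f e * ?m f' e' * F (f O s O f'))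
      = (\<Sum>f\<in>{f \<in> ?E. f \<subseteq> e}. \<Sum>f'\<in>{f' \<in> ?E. f' \<subseteq> e'}. ?m f e * ?m f' e' * F (f O t O f'))"
    by (intro sum.cong refl) (auto simp: ft)
  ultimately show ?thesis by simp
qed

text \<open>
  The two hypotheses on sums say that the operators \<open>P e\<close> and \<open>P e'\<close> by which \<open>\<epsilon>\<^sub>e\<close> and \<open>\<epsilon>\<^sub>e\<^sub>'\<close> act have nonzero
  trace. If \<open>e\<close> and \<open>e'\<close> were not isomorphic, the invariant subspace \<open>W\<close> of the vectors \<open>v\<close> with \<open>\<epsilon>\<^sub>e s v = 0\<close> for
  all \<open>s\<close> would contain the image of \<open>P e'\<close>, so that \<open>W \<noteq> 0\<close>; but \<open>W\<close> is not the whole space, because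
  \<open>\<epsilon>\<^sub>e e = \<epsilon>\<^sub>e\<close> acts nontrivially.
\<close>

lemma isomorphic_if_irreducible:
  fixes \<chi> :: "pperm \<Rightarrow> 'a::field"
  assumes \<chi>: "\<chi> \<in> Irr S" and e: "e \<in> idempotents S" and e': "e' \<in> idempotents S"
    and nz: "(\<Sum>f\<in>{f \<in> idempotents S. f \<subseteq> e}. of_int (moebius (idempotents S) f e) * \<chi> f) \<noteq> 0"
    and nz': "(\<Sum>f\<in>{f \<in> idempotents S. f \<subseteq> e'}. of_int (moebius (idempotents S) f e') * \<chi> f) \<noteq> 0"
  shows "isomorphic_idempotents S e e'"
proof (rule ccontr)
  assume not_iso: "\<not> isomorphic_idempotents S e e'"
  let ?E = "idempotents S"
  let ?D = "\<lambda>e. {f \<in> ?E. f \<subseteq> e}"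
  let ?m = "\<lambda>f e. of_int (moebius ?E f e) :: 'a"
  obtain d \<rho> where irr: "irreducible_rep S d \<rho>" and \<chi>\<rho>: "\<And>s. s \<in> S \<Longrightarrow> \<chi> s = character \<rho> s"
    using \<chi> unfolding Irr_def by blast
  have \<rho>: "\<rho> s \<in> carrier_mat d d" if "s \<in> S" for s
    using irr that by (simp add: irreducible_rep_def representation_def)
  have \<rho>_mult: "\<rho> (s O t) = \<rho> s * \<rho> t" if "s \<in> S" "t \<in> S" for s t
    using irr that by (simp add: irreducible_rep_def representation_def)
  have E: "f \<in> S" if "f \<in> ?D e" for f e using that idempotent_in by simp
  have trace: "(\<Sum>f\<in>?D e. ?m f e * \<chi> f) = (\<Sum>i<d. \<Sum>f\<in>?D e. ?m f e * (\<rho> f *\<^sub>v unit_vec d i) $ i)" for e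
  proof -
    have "(\<Sum>f\<in>?D e. ?m f e * \<chi> f) = (\<Sum>f\<in>?D e. \<Sum>i<d. ?m f e * (\<rho> f *\<^sub>v unit_vec d i) $ i)"
    proof (intro sum.cong refl)
      fix f assume "f \<in> ?D e"
      note \<rho>f = \<rho>[OF E[OF this]] and \<chi>f = \<chi>\<rho>[OF E[OF this]]
      show "?m f e * \<chi> f = (\<Sum>i<d. ?m f e * (\<rho> f *\<^sub>v unit_vec d i) $ i)"
        unfolding \<chi>f character_def sum_distrib_left using carrier_matD[OF \<rho>f]
        by (intro sum.cong) (auto simp: mat_mult_unit_vec[OF \<rho>f])
    qed
    then show ?thesis by (subst (asm) sum.swap)
  qed
  define P where "P e v = vec_sum d (?D e) (\<lambda>f. ?m f e) (\<lambda>f. \<rho> f *\<^sub>v v)" for e v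
  have P_trace: "(\<Sum>f\<in>?D e. ?m f e * \<chi> f) = (\<Sum>i<d. P e (unit_vec d i) $ i)" for e
    unfolding trace by (intro sum.cong refl) (simp add: P_def)
  have P_linear: "P e (u + v) = P e u + P e v" "P e (c \<cdot>\<^sub>v u) = c \<cdot>\<^sub>v P e u"
    if "u \<in> carrier_vec d" "v \<in> carrier_vec d" for e u v c
  proof -
    have "(\<rho> f *\<^sub>v (u + v)) $ i = (\<rho> f *\<^sub>v u) $ i + (\<rho> f *\<^sub>v v) $ i"
      "(\<rho> f *\<^sub>v (c \<cdot>\<^sub>v u)) $ i = c * (\<rho> f *\<^sub>v u) $ i" if "f \<in> ?D e" "i < d" for f i
      using mult_add_distrib_mat_vec[OF \<rho>[OF E[OF that(1)]] \<open>u \<in> _\<close> \<open>v \<in> _\<close>]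
        mult_mat_vec[OF \<rho>[OF E[OF that(1)]] \<open>u \<in> _\<close>, of c] carrier_matD[OF \<rho>[OF E[OF that(1)]]] that(2)
      by simp_all
    then show "P e (u + v) = P e u + P e v" "P e (c \<cdot>\<^sub>v u) = c \<cdot>\<^sub>v P e u"
      by (intro eq_vecI; simp add: P_def distrib_left sum.distrib sum_distrib_left mult.left_commute)+
  qed
  define W where "W = {v \<in> carrier_vec d. \<forall>s\<in>S. P e (\<rho> s *\<^sub>v v) = 0\<^sub>v d}"
  have W: "subspace class_ring W (module_vec TYPE('a) d)"
    unfolding subspace_vec_iff
  proof (intro conjI ballI allI)
    have c: "\<rho> s *\<^sub>v v \<in> carrier_vec d" if "s \<in> S" "v \<in> carrier_vec d" for s v
      using \<rho>[OF that(1)] that(2) by (rule mult_mat_vec_carrier)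
    have \<rho>0: "\<rho> s *\<^sub>v 0\<^sub>v d = 0\<^sub>v d" if "s \<in> S" for s using \<rho>[OF that] by auto
    have "P e (0\<^sub>v d) = 0\<^sub>v d"
    proof (rule eq_vecI)
      fix i assume "i < dim_vec (0\<^sub>v d :: 'a vec)"
      then show "P e (0\<^sub>v d) $ i = 0\<^sub>v d $ i"
        using \<rho>0[OF E] by (auto simp: P_def intro!: sum.neutral)
    qed (simp add: P_def)
    then show "0\<^sub>v d \<in> W" by (simp add: W_def \<rho>0)
    show "u + v \<in> W" if "u \<in> W" "v \<in> W" for u v
      using that mult_add_distrib_mat_vec[OF \<rho>] by (auto simp: W_def P_linear c)
    show "x \<cdot>\<^sub>v v \<in> W" if "v \<in> W" for x v
      using that mult_mat_vec[OF \<rho>] by (auto simp: W_def P_linear(2)[OF c c])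
  qed (auto simp: W_def)
  have "\<rho> t *\<^sub>v v \<in> W" if "t \<in> S" "v \<in> W" for t v
  proof -
    have v: "v \<in> carrier_vec d" using that by (simp add: W_def)
    have "\<rho> s *\<^sub>v (\<rho> t *\<^sub>v v) = \<rho> (s O t) *\<^sub>v v" if "s \<in> S" for s
      using \<rho>_mult[OF that \<open>t \<in> S\<close>] assoc_mult_mat_vec[OF \<rho>[OF that] \<rho>[OF \<open>t \<in> S\<close>] v] by simp
    then show ?thesis
      using that mult_closed mult_mat_vec_carrier[OF \<rho>[OF that(1)] v] by (simp add: W_def)
  qed
  with W irr have "W = {0\<^sub>v d} \<or> W = carrier_vec d" unfolding irreducible_rep_def by blast
  then show False
  proof
    assume W0: "W = {0\<^sub>v d}"
    have "P e' v \<in> W" if v: "v \<in> carrier_vec d" for v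
    proof -
      have "P e (\<rho> s *\<^sub>v P e' v) $ i = 0" if s: "s \<in> S" and i: "i < d" for s i
      proof -
        have c: "\<rho> f *\<^sub>v v \<in> carrier_vec d" if "f \<in> ?D e'" for f
          using \<rho>[OF E[OF that]] v by (rule mult_mat_vec_carrier)
        have "(\<rho> f *\<^sub>v (\<rho> s *\<^sub>v P e' v)) $ i = (\<Sum>f'\<in>?D e'. ?m f' e' * (\<rho> (f O s O f') *\<^sub>v v) $ i)"
          if f: "f \<in> ?D e" for f
        proof -
          have "\<rho> f *\<^sub>v (\<rho> s *\<^sub>v P e' v) = (\<rho> f * \<rho> s) *\<^sub>v P e' v"
            by (rule assoc_mult_mat_vec[OF \<rho>[OF E[OF f]] \<rho>[OF s], symmetric]) (simp add: P_def)
          also have "\<dots> = vec_sum d (?D e') (\<lambda>f'. ?m f' e') (\<lambda>f'. (\<rho> f * \<rho> s) *\<^sub>v (\<rho> f' *\<^sub>v v))"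
            unfolding P_def using \<rho>[OF E[OF f]] \<rho>[OF s] c by (intro mult_mat_vec_sum) auto
          also have "\<dots> $ i = (\<Sum>f'\<in>?D e'. ?m f' e' * ((\<rho> f * \<rho> s) *\<^sub>v (\<rho> f' *\<^sub>v v)) $ i)"
            using i by simp
          also have "\<dots> = (\<Sum>f'\<in>?D e'. ?m f' e' * (\<rho> (f O s O f') *\<^sub>v v) $ i)"
          proof (intro sum.cong refl)
            fix f' assume f': "f' \<in> ?D e'"
            have "\<rho> (f O s O f') = (\<rho> f * \<rho> s) * \<rho> f'"
              using \<rho>_mult E[OF f] E[OF f'] s mult_closed by (metis O_assoc)
            then have "\<rho> (f O s O f') *\<^sub>v v = (\<rho> f * \<rho> s) *\<^sub>v (\<rho> f' *\<^sub>v v)"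
              using assoc_mult_mat_vec[OF mult_carrier_mat[OF \<rho>[OF E[OF f]] \<rho>[OF s]] \<rho>[OF E[OF f']] v] by simp
            then show "?m f' e' * ((\<rho> f * \<rho> s) *\<^sub>v (\<rho> f' *\<^sub>v v)) $ i = ?m f' e' * (\<rho> (f O s O f') *\<^sub>v v) $ i"
              by simp
          qed
          finally show ?thesis .
        qed
        then have "P e (\<rho> s *\<^sub>v P e' v) $ i
            = (\<Sum>f\<in>?D e. \<Sum>f'\<in>?D e'. ?m f e * ?m f' e' * (\<rho> (f O s O f') *\<^sub>v v) $ i)"
          unfolding P_def[of e] using i by (simp add: sum_distrib_left mult.assoc)
        also have "\<dots> = 0" by (rule moebius_sums_separate[OF e e' s not_iso])
        finally show ?thesis .
      qed
      then show ?thesis by (auto simp: W_def P_def intro!: eq_vecI)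
    qed
    then have "P e' v = 0\<^sub>v d" if "v \<in> carrier_vec d" for v using W0 that by blast
    then have "(\<Sum>f\<in>?D e'. ?m f e' * \<chi> f) = 0" unfolding P_trace by simp
    then show False using nz' by simp
  next
    assume W1: "W = carrier_vec d"
    have "P e v = 0\<^sub>v d" if v: "v \<in> carrier_vec d" for v
    proof -
      have "P e (\<rho> e *\<^sub>v v) = 0\<^sub>v d" using W1 v idempotent_in[OF e] by (auto simp: W_def)
      moreover have "\<rho> f *\<^sub>v (\<rho> e *\<^sub>v v) = \<rho> f *\<^sub>v v" if f: "f \<in> ?D e" for f
      proof -
        have "f O e = f" using idempotents_inter(1)[of f e] f e by auto
        then show ?thesis
          using \<rho>_mult[OF E[OF f] idempotent_in[OF e]]
            assoc_mult_mat_vec[OF \<rho>[OF E[OF f]] \<rho>[OF idempotent_in[OF e]] v] by simp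
      qed
      then have "P e (\<rho> e *\<^sub>v v) = P e v" unfolding P_def by (intro eq_vecI) simp_all
      ultimately show ?thesis by simp
    qed
    then have "(\<Sum>f\<in>?D e. ?m f e * \<chi> f) = 0" unfolding P_trace by simp
    then show False using nz by simp
  qed
qed

end

section \<open>Irreducibility of the exterior power\<close>

lemma rook_mat_carrier [simp]: "rook_mat n s \<in> carrier_mat n n"
  by (simp add: rook_mat_def)

lemma rook_mat_mult:
  assumes s: "s \<in> partial_perms n" and t: "t \<in> partial_perms n"
  shows "rook_mat n (s O t) = (rook_mat n s * rook_mat n t :: 'a::field mat)"
proof (rule eq_matI)
  fix i j assume "i < dim_row (rook_mat n s * rook_mat n t :: 'a mat)"
    "j < dim_col (rook_mat n s * rook_mat n t :: 'a mat)"
  then have ij: "i < n" "j < n" by (simp_all add: rook_mat_def)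
  let ?f = "\<lambda>k. (if (Suc i, Suc k) \<in> s then 1 else 0) * (if (Suc k, Suc j) \<in> t then 1 else 0) :: 'a"
  have "(rook_mat n s * rook_mat n t :: 'a mat) $$ (i, j) = (\<Sum>k = 0..<n. ?f k)"
    using ij by (simp add: rook_mat_def scalar_prod_def)
  also have "\<dots> = (if (Suc i, Suc j) \<in> s O t then 1 else 0)"
  proof (cases "(Suc i, Suc j) \<in> s O t")
    case True
    then obtain x where x: "(Suc i, x) \<in> s" "(x, Suc j) \<in> t" by blast
    then obtain k where k: "x = Suc k" "k < n"
      using partial_permsD(3)[OF s x(1)] by (cases x) auto
    have "(Suc i, Suc l) \<in> s \<longleftrightarrow> l = k" for l
      using partial_permsD(1)[OF s x(1), of "Suc l"] x(1) k(1) by blast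
    then have "?f l = (if l = k then 1 else 0)" for l
      using x(2) k(1) by simp
    then show ?thesis using True k by simp
  next
    case False
    then have "?f l = 0" for l by auto
    with False show ?thesis by simp
  qed
  also have "\<dots> = (rook_mat n (s O t) :: 'a mat) $$ (i, j)" using ij by (simp add: rook_mat_def)
  finally show "rook_mat n (s O t) $$ (i, j) = (rook_mat n s * rook_mat n t :: 'a mat) $$ (i, j)" by simp
qed (simp_all add: rook_mat_def)

lemma rook_mat_unit_vec:
  assumes s: "s \<in> partial_perms n" and "j < n"
  shows "(Suc i, Suc j) \<in> s \<Longrightarrow> rook_mat n s *\<^sub>v unit_vec n j = (unit_vec n i :: 'a::field vec)"
    and "Suc j \<notin> Range s \<Longrightarrow> rook_mat n s *\<^sub>v unit_vec n j = (0\<^sub>v n :: 'a vec)"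
proof -
  have col: "(rook_mat n s *\<^sub>v unit_vec n j) $ k = (if (Suc k, Suc j) \<in> s then 1 else 0 :: 'a)" if "k < n" for k
    using that \<open>j < n\<close> by (simp add: mat_mult_unit_vec[OF rook_mat_carrier]) (simp add: rook_mat_def)
  show "rook_mat n s *\<^sub>v unit_vec n j = (0\<^sub>v n :: 'a vec)" if "Suc j \<notin> Range s"
  proof (rule eq_vecI)
    fix k assume "k < dim_vec (0\<^sub>v n :: 'a vec)"
    then show "(rook_mat n s *\<^sub>v unit_vec n j) $ k = (0\<^sub>v n :: 'a vec) $ k" using that by (auto simp: col)
  qed (simp add: rook_mat_def)
  show "rook_mat n s *\<^sub>v unit_vec n j = (unit_vec n i :: 'a vec)" if ij: "(Suc i, Suc j) \<in> s"
  proof (rule eq_vecI)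
    fix k assume "k < dim_vec (unit_vec n i :: 'a vec)"
    then have k: "k < n" by simp
    have "i < n" using partial_permsD(3)[OF s ij] by simp
    moreover have "(Suc k, Suc j) \<in> s \<longleftrightarrow> k = i" using partial_permsD(2)[OF s _ ij] ij by auto
    ultimately show "(rook_mat n s *\<^sub>v unit_vec n j) $ k = (unit_vec n i :: 'a vec) $ k"
      using k by (simp add: col)
  qed (simp add: rook_mat_def)
qed

lemma alternating_map_zero_entry:
  fixes f :: "'a::field vec list \<Rightarrow> 'a vec"
  assumes f: "alternating_map n p m f" and vs: "vs \<in> vec_tuples n p" and i: "i < p" "vs ! i = 0\<^sub>v n"
  shows "f vs = 0\<^sub>v m"
proof -
  have "f (vs[i := 0 \<cdot>\<^sub>v 0\<^sub>v n]) = 0 \<cdot>\<^sub>v f (vs[i := 0\<^sub>v n])"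
    by (rule alternating_mapD(3)[OF f vs i(1)]) simp
  moreover have "vs[i := 0\<^sub>v n] = vs" using i by (metis list_update_id)
  moreover have "0 \<cdot>\<^sub>v 0\<^sub>v n = (0\<^sub>v n :: 'a vec)" by (intro eq_vecI) auto
  ultimately have "f vs = 0 \<cdot>\<^sub>v f vs" by simp
  also have "\<dots> = 0\<^sub>v m" using alternating_mapD(1)[OF f vs] by (intro eq_vecI) auto
  finally show ?thesis .
qed

context contains_rank
begin

text \<open>
  The rank \<open>p\<close> idempotents of \<open>S\<close> act as projections to the lines spanned by the single basis elements, and
  elements realising isomorphisms permute these lines transitively. So an invariant subspace with a
  nonzero vector contains some basis element, and then all of them.
\<close>

lemma exterior_power_irreducible:
  fixes \<rho> :: "pperm \<Rightarrow> 'a::field mat"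
  assumes \<rho>: "exterior_power_rep S n (rook_mat n) p d \<rho>"
    and iso: "\<And>e f. e \<in> idempotents S \<Longrightarrow> f \<in> idempotents S \<Longrightarrow> rk e = p \<Longrightarrow> rk f = p \<Longrightarrow>
      isomorphic_idempotents S e f"
  shows "irreducible_rep S d \<rho>"
proof -
  let ?L = "index_lists n p" and ?R = "rook_mat n :: pperm \<Rightarrow> 'a mat"
  let ?units = "map (unit_vec n) :: nat list \<Rightarrow> 'a vec list"
  define N where "N = length ?L"
  obtain w where w: "is_exterior_power n p d w"
    and \<rho>c: "\<And>s. s \<in> S \<Longrightarrow> \<rho> s \<in> carrier_mat d d"
    and \<rho>w: "\<And>s vs. s \<in> S \<Longrightarrow> vs \<in> vec_tuples n p \<Longrightarrow> \<rho> s *\<^sub>v w vs = w (map (\<lambda>v. ?R s *\<^sub>v v) vs)"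
    using \<rho> unfolding exterior_power_rep_def by blast
  obtain B C where B: "B \<in> carrier_mat N d" and C: "C \<in> carrier_mat d N"
    and BC: "B * C = 1\<^sub>m N" and CB: "C * B = 1\<^sub>m d"
    and colC: "\<And>k. k < N \<Longrightarrow> col C k = w (?units (?L ! k))"
    using exterior_power_basis[OF w, folded N_def] by (elim exE conjE) (rule that; blast)
  have alt: "alternating_map n p d w" using w by (simp add: is_exterior_power_def)
  have wc: "w vs \<in> carrier_vec d" if "vs \<in> vec_tuples n p" for vs
    using alternating_mapD(1)[OF alt that] .
  have image: "map (\<lambda>v. ?R s *\<^sub>v v) vs \<in> vec_tuples n p" if "vs \<in> vec_tuples n p" for s vs
    using that mult_mat_vec_carrier[OF rook_mat_carrier] by (auto simp: vec_tuples_def)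
  have L: "?L ! k \<in> set ?L" "length (?L ! k) = p" "\<And>i. i < p \<Longrightarrow> ?L ! k ! i < n"
    "?units (?L ! k) \<in> vec_tuples n p" if "k < N" for k
    using nth_mem[OF that[unfolded N_def]] by (auto simp: set_index_lists subset_iff vec_tuples_def)
  have rep: "representation S d \<rho>"
    unfolding representation_def
  proof (intro conjI ballI)
    fix s t assume s: "s \<in> S" and t: "t \<in> S"
    show "\<rho> (s O t) = \<rho> s * \<rho> t"
    proof (rule exterior_power_mat_eqI[OF w])
      fix vs :: "'a vec list" assume vs: "vs \<in> vec_tuples n p"
      have "?R (s O t) *\<^sub>v v = ?R s *\<^sub>v (?R t *\<^sub>v v)" if "v \<in> carrier_vec n" for v
        unfolding rook_mat_mult[OF partial_perm[OF s] partial_perm[OF t]]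
        by (rule assoc_mult_mat_vec[OF rook_mat_carrier rook_mat_carrier that])
      then have "map (\<lambda>v. ?R (s O t) *\<^sub>v v) vs = map (\<lambda>v. ?R s *\<^sub>v v) (map (\<lambda>v. ?R t *\<^sub>v v) vs)"
        using vs by (auto simp: vec_tuples_def)
      then have "\<rho> (s O t) *\<^sub>v w vs = \<rho> s *\<^sub>v (\<rho> t *\<^sub>v w vs)"
        by (simp only: \<rho>w[OF mult_closed[OF s t] vs] \<rho>w[OF t vs] \<rho>w[OF s image[OF vs]])
      then show "\<rho> (s O t) *\<^sub>v w vs = \<rho> s * \<rho> t *\<^sub>v w vs"
        using assoc_mult_mat_vec[OF \<rho>c[OF s] \<rho>c[OF t] wc[OF vs]] by simp
    qed (rule \<rho>c[OF mult_closed[OF s t]], rule mult_carrier_mat[OF \<rho>c[OF s] \<rho>c[OF t]])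
  qed (rule \<rho>c)
  define idem where "idem k = Id_on (support (?L ! k))" for k
  have idem: "idem k \<in> idempotents S" "rk (idem k) = p" if "k < N" for k
    using support_idempotent[OF L(1)[OF that]] by (simp_all add: idem_def)
  \<comment> \<open>In the basis given by the columns of \<open>C\<close>, the rank \<open>p\<close> idempotents are the diagonal matrix units:
    if \<open>k \<noteq> m\<close> then some index in the \<open>m\<close>-th list lies outside the range of \<open>idem k\<close>, so that one of the
    factors of the \<open>m\<close>-th basis element is sent to zero.\<close>
  have idem_act: "\<rho> (idem k) *\<^sub>v col C m = (if m = k then col C k else 0\<^sub>v d)" if k: "k < N" and m: "m < N" for k m
  proof -
    have act: "\<rho> (idem k) *\<^sub>v col C m = w (map (\<lambda>v. ?R (idem k) *\<^sub>v v) (?units (?L ! m)))"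
      unfolding colC[OF m] by (rule \<rho>w[OF idempotent_in[OF idem(1)[OF k]] L(4)[OF m]])
    note pp = partial_perm[OF idempotent_in[OF idem(1)[OF k]]]
    show ?thesis
    proof (cases "m = k")
      case True
      have "?R (idem k) *\<^sub>v unit_vec n j = unit_vec n j" if "j \<in> set (?L ! k)" for j
      proof (rule rook_mat_unit_vec(1)[OF pp])
        show "j < n" using L(1)[OF k] that by (auto simp: set_index_lists)
        show "(Suc j, Suc j) \<in> idem k" using that by (auto simp: idem_def support_def)
      qed
      then have eq: "map (\<lambda>v. ?R (idem k) *\<^sub>v v) (?units (?L ! m)) = ?units (?L ! m)" using True by simp
      show ?thesis unfolding act eq using True colC[OF k] by simp
    next
      case False
      then have "?L ! m \<noteq> ?L ! k"
        using nth_eq_iff_index_eq[OF distinct_index_lists] k m unfolding N_def by blast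
      then have "\<not> support (?L ! m) \<subseteq> support (?L ! k)"
        using support_subset_imp_eq[OF L(1)[OF k] L(1)[OF m]] by auto
      then obtain j where j: "j \<in> set (?L ! m)" "Suc j \<notin> support (?L ! k)" by (auto simp: support_def)
      then obtain i where i: "i < p" "?L ! m ! i = j" using L(2)[OF m] by (metis in_set_conv_nth)
      have "?R (idem k) *\<^sub>v unit_vec n j = 0\<^sub>v n"
        by (rule rook_mat_unit_vec(2)[OF pp]) (use i L(3)[OF m i(1)] j(2) in \<open>auto simp: idem_def\<close>)
      then have "w (map (\<lambda>v. ?R (idem k) *\<^sub>v v) (?units (?L ! m))) = 0\<^sub>v d"
        using i L(2)[OF m] by (intro alternating_map_zero_entry[OF alt image[OF L(4)[OF m]] i(1)]) simp
      then show ?thesis using act False by simp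
    qed
  qed
  have colC0: "col C k \<noteq> 0\<^sub>v d" if k: "k < N" for k
  proof
    assume "col C k = 0\<^sub>v d"
    then have "B *\<^sub>v col C k = 0\<^sub>v N" using B by auto
    moreover have "B *\<^sub>v col C k = col (B * C) k" using col_mult2[OF B C k] by simp
    ultimately have "unit_vec N k = (0\<^sub>v N :: 'a vec)" using BC k by simp
    then show False using unit_vec_nonzero[OF k, where 'a = 'a] by simp
  qed
  have nonzero: "\<exists>s\<in>S. \<rho> s \<noteq> 0\<^sub>m d d"
  proof -
    obtain xs where "xs \<in> set ?L"
      using index_list_of_set[of "{1..p}" n p] p_le_n by auto
    then have k: "0 < N" by (auto simp: N_def)
    have "\<rho> (idem 0) \<noteq> 0\<^sub>m d d"
    proof
      assume "\<rho> (idem 0) = 0\<^sub>m d d"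
      then have "col C 0 = 0\<^sub>m d d *\<^sub>v col C 0" using idem_act[OF k k] by simp
      also have "\<dots> = 0\<^sub>v d" using C by (intro eq_vecI) auto
      finally show False using colC0[OF k] by simp
    qed
    then show ?thesis using idempotent_in[OF idem(1)[OF k]] by blast
  qed
  \<comment> \<open>An \<open>s\<close> that realises the isomorphism of the two idempotents carries the factors of one basis
    element to a permutation of those of the other, whence the sign \<open>c\<close>.\<close>
  have move: "\<exists>s\<in>S. \<exists>c. col C m = c \<cdot>\<^sub>v (\<rho> s *\<^sub>v col C k)" if k: "k < N" and m: "m < N" for k m
  proof -
    obtain s where s: "s \<in> S" "s O s\<inverse> = idem m" "s\<inverse> O s = idem k"
      using iso[OF idem(1)[OF m] idem(1)[OF k] idem(2)[OF m] idem(2)[OF k]]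
      unfolding isomorphic_idempotents_def by blast
    note pp = partial_perm[OF s(1)]
    have dom: "Domain s = support (?L ! m)" and ran: "Range s = support (?L ! k)"
      using s inverse_mult(1,2)[OF s(1)] unfolding idem_def by (metis Domain_Id_on)+
    have "\<exists>i. (Suc i, Suc j) \<in> s" if "j \<in> set (?L ! k)" for j
    proof -
      have "Suc j \<in> Range s" using that ran by (simp add: support_def)
      then obtain x where x: "(x, Suc j) \<in> s" by blast
      then have "x \<in> support (?L ! m)" using dom by blast
      then show ?thesis using x by (auto simp: support_def)
    qed
    then obtain f where f: "\<And>j. j \<in> set (?L ! k) \<Longrightarrow> (Suc (f j), Suc j) \<in> s" by metis
    define zs where "zs = map f (?L ! k)"
    have "set zs = set (?L ! m)"
    proof
      show "set zs \<subseteq> set (?L ! m)"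
        unfolding zs_def using f dom by (auto simp: support_def dest: DomainI)
      show "set (?L ! m) \<subseteq> set zs"
      proof
        fix i assume "i \<in> set (?L ! m)"
        then have "Suc i \<in> Domain s" using dom by (simp add: support_def)
        then obtain y where y: "(Suc i, y) \<in> s" by blast
        then have "y \<in> support (?L ! k)" using ran by blast
        then obtain j where j: "y = Suc j" "j \<in> set (?L ! k)" by (auto simp: support_def)
        then have "f j = i" using partial_permsD(2)[OF pp f[OF j(2)], of "Suc i"] y by simp
        then show "i \<in> set zs" using j(2) by (auto simp: zs_def)
      qed
    qed
    moreover have "inj_on f (set (?L ! k))"
      using partial_permsD(1)[OF pp f] f by (intro inj_onI) (metis nat.inject)
    then have "distinct zs" using support_index_list(3)[OF L(1)[OF k]] by (simp add: zs_def distinct_map)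
    ultimately have "mset zs = mset (?L ! m)"
      using support_index_list(3)[OF L(1)[OF m]] set_eq_iff_mset_eq_distinct by blast
    then obtain \<pi> where \<pi>: "\<pi> permutes {..<p}" "permute_list \<pi> (?L ! m) = zs"
      using mset_eq_permutation[of zs "?L ! m"] L(2)[OF m] by auto
    have "map (\<lambda>v. ?R s *\<^sub>v v) (?units (?L ! k)) = ?units zs"
      using rook_mat_unit_vec(1)[OF pp _ f] L(1)[OF k] by (auto simp: zs_def set_index_lists subset_iff)
    also have "\<dots> = map (\<lambda>i. ?units (?L ! m) ! \<pi> i) [0..<p]"
      using permutes_in_image[OF \<pi>(1)] L(2)[OF m] by (subst \<pi>(2)[symmetric]) (simp add: permute_list_def)
    finally have "\<rho> s *\<^sub>v col C k = of_int (sign \<pi>) \<cdot>\<^sub>v col C m"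
      using \<rho>w[OF s(1) L(4)[OF k]] alternating_map_permute[OF alt \<pi>(1) L(4)[OF m]] colC k m by simp
    then have "of_int (sign \<pi>) \<cdot>\<^sub>v (\<rho> s *\<^sub>v col C k) = (of_int (sign \<pi> * sign \<pi>)) \<cdot>\<^sub>v col C m"
      by (simp only: smult_smult_assoc of_int_mult)
    also have "sign \<pi> * sign \<pi> = 1" by (simp add: sign_def)
    also have "of_int 1 \<cdot>\<^sub>v col C m = col C m" by (intro eq_vecI) auto
    finally show ?thesis using s(1) by metis
  qed
  have "W = carrier_vec d"
    if W: "subspace class_ring W (module_vec TYPE('a) d)" and inv: "\<forall>s\<in>S. \<forall>v\<in>W. \<rho> s *\<^sub>v v \<in> W"
      and nz: "W \<noteq> {0\<^sub>v d}" for W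
  proof -
    note W' = W[unfolded subspace_vec_iff]
    have expand: "v = vec_sum d {..<N} (\<lambda>m. (B *\<^sub>v v) $ m) (col C)" if v: "v \<in> carrier_vec d" for v
    proof -
      have "v = C *\<^sub>v (B *\<^sub>v v)" using assoc_mult_mat_vec[OF C B v] CB v by simp
      also have "\<dots> = vec_sum d {..<N} (\<lambda>m. (B *\<^sub>v v) $ m) (col C)"
      proof (rule eq_vecI)
        fix i assume "i < dim_vec (vec_sum d {..<N} (\<lambda>m. (B *\<^sub>v v) $ m) (col C))"
        then have "i < d" by simp
        then show "(C *\<^sub>v (B *\<^sub>v v)) $ i = vec_sum d {..<N} (\<lambda>m. (B *\<^sub>v v) $ m) (col C) $ i"
          using B C v by (simp add: scalar_prod_def atLeast0LessThan mult.commute)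
      qed (use C in simp)
      finally show ?thesis .
    qed
    obtain v where v: "v \<in> W" "v \<noteq> 0\<^sub>v d" using W' nz by blast
    then have vc: "v \<in> carrier_vec d" using W' by blast
    have "\<exists>k<N. (B *\<^sub>v v) $ k \<noteq> 0"
    proof (rule ccontr)
      assume "\<not> ?thesis"
      then have "vec_sum d {..<N} (\<lambda>m. (B *\<^sub>v v) $ m) (col C) = 0\<^sub>v d" by (intro eq_vecI) auto
      then show False using expand[OF vc] v(2) by simp
    qed
    then obtain k where k: "k < N" "(B *\<^sub>v v) $ k \<noteq> 0" by blast
    \<comment> \<open>Applying the \<open>k\<close>-th matrix unit to \<open>v\<close> leaves only its \<open>k\<close>-th component, which is then in \<open>W\<close>.\<close>
    let ?c = "(B *\<^sub>v v) $ k"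
    have "\<rho> (idem k) *\<^sub>v v = vec_sum d {..<N} (\<lambda>m. (B *\<^sub>v v) $ m) (\<lambda>m. \<rho> (idem k) *\<^sub>v col C m)"
      using C by (subst (1) expand[OF vc], intro mult_mat_vec_sum[OF \<rho>c[OF idempotent_in[OF idem(1)[OF k(1)]]]]) auto
    also have "\<dots> = ?c \<cdot>\<^sub>v col C k"
    proof (rule eq_vecI)
      fix i assume "i < dim_vec (?c \<cdot>\<^sub>v col C k)"
      then have i: "i < d" using C by simp
      have "vec_sum d {..<N} (\<lambda>m. (B *\<^sub>v v) $ m) (\<lambda>m. \<rho> (idem k) *\<^sub>v col C m) $ i
          = (\<Sum>m<N. (B *\<^sub>v v) $ m * (\<rho> (idem k) *\<^sub>v col C m) $ i)" using i by simp
      also have "\<dots> = (\<Sum>m<N. if m = k then ?c * col C k $ i else 0)"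
        by (intro sum.cong refl) (use idem_act[OF k(1)] i in auto)
      also have "\<dots> = (?c \<cdot>\<^sub>v col C k) $ i" using k(1) i C by simp
      finally show "vec_sum d {..<N} (\<lambda>m. (B *\<^sub>v v) $ m) (\<lambda>m. \<rho> (idem k) *\<^sub>v col C m) $ i
        = (?c \<cdot>\<^sub>v col C k) $ i" .
    qed (use C in simp)
    finally have "?c \<cdot>\<^sub>v col C k \<in> W" using inv v(1) idempotent_in[OF idem(1)[OF k(1)]] by metis
    then have "inverse ?c \<cdot>\<^sub>v (?c \<cdot>\<^sub>v col C k) \<in> W" using W' by blast
    then have colk: "col C k \<in> W" using k(2) by (simp add: smult_smult_assoc)
    have cols: "col C m \<in> W" if m: "m < N" for m
    proof -
      obtain s c where "s \<in> S" "col C m = c \<cdot>\<^sub>v (\<rho> s *\<^sub>v col C k)" using move[OF k(1) m] by blast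
      then show ?thesis using inv colk W' by simp
    qed
    have "u \<in> W" if "u \<in> carrier_vec d" for u
      by (subst expand[OF that]) (intro vec_sum_in_subspace[OF W], use cols in auto)
    then show ?thesis using W' by blast
  qed
  then show ?thesis unfolding irreducible_rep_def using rep nonzero by blast
qed

end

section \<open>The bracket and the criterion of irreducibility\<close>

lemma partial_perms_contains_rank:
  assumes "q \<le> n"
  shows "contains_rank n (partial_perms n) q"
  using assms inverse_subsemigroup_partial_perms
  by unfold_locales (auto simp: idempotents_def)

lemma partial_perms_isomorphic:
  assumes e: "e \<in> idempotents (partial_perms n)" and f: "f \<in> idempotents (partial_perms n)"
    and rk: "rk e = rk f"
  shows "isomorphic_idempotents (partial_perms n) e f"
proof -
  interpret pperm_inverse_semigroup n "partial_perms n"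
    by unfold_locales (rule inverse_subsemigroup_partial_perms)
  obtain X Y where XY: "e = Id_on X" "f = Id_on Y" using idempotent_eq_Id_on e f by metis
  have sub: "X \<subseteq> {1..n}" "Y \<subseteq> {1..n}"
    using idempotent_in[OF e] idempotent_in[OF f] unfolding XY partial_perms_def by auto
  have "card X = card Y" using rk by (simp add: XY rk_def)
  moreover have "finite X" "finite Y" using sub finite_subset by blast+
  ultimately obtain h where h: "bij_betw h X Y" using finite_same_card_bij by blast
  define s where "s = {(x, h x) | x. x \<in> X}"
  have "single_valued s" by (auto simp: s_def single_valued_def)
  moreover have "single_valued (s\<inverse>)"
    using h by (auto simp: s_def single_valued_def bij_betw_def dest: inj_onD)
  moreover have "h x \<in> Y" if "x \<in> X" for x using h that bij_betwE by blast
  then have "s \<subseteq> {1..n} \<times> {1..n}" using sub unfolding s_def by blast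
  ultimately have s: "s \<in> partial_perms n" by (simp add: partial_perms_def)
  have "Domain s = X" "Range s = Y" using h by (auto simp: s_def bij_betw_def)
  then have "s O s\<inverse> = e" "s\<inverse> O s = f" using inverse_mult(1,2)[OF s] XY by simp_all
  with s show ?thesis unfolding isomorphic_idempotents_def by blast
qed

context contains_rank
begin

text \<open>
  Summing over \<open>f\<close> first reduces the bracket to zero or, if \<open>e\<close> has rank \<open>p\<close>, to the inner product of
  \<open>\<chi>\<close> with the sign character.
\<close>

lemma char_prod_exterior_power:
  fixes \<rho> :: "pperm \<Rightarrow> 'a::field_char_0 mat"
  assumes \<rho>: "exterior_power_rep S n (rook_mat n) p d \<rho>"
    and e: "e \<in> idempotents S" and \<chi>: "\<chi> \<in> Irr (maximal_subgroup S e)"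
  shows "char_prod S e \<chi> (character \<rho>) =
    (if rk e = p \<and> (\<forall>g\<in>maximal_subgroup S e. \<chi> g = sgn_at e g) then 1 else 0)"
proof -
  let ?G = "maximal_subgroup S e" and ?E = "idempotents S"
  let ?D = "{f \<in> ?E. f \<subseteq> e}"
  let ?m = "\<lambda>f. of_int (moebius ?E f e) :: 'a"
  have G: "g \<in> S" if "g \<in> ?G" for g using that by (simp add: maximal_subgroup_def)
  have "char_prod S e \<chi> (character \<rho>)
      = (\<Sum>f\<in>?D. \<Sum>g\<in>?G. 1 / of_nat (card ?G) * \<chi> (g\<inverse>) * (?m f * exterior_character (f O g)))"
    unfolding char_prod_def sum_distrib_left sum_distrib_right
    using character_rook_exterior_power[OF \<rho> mult_closed[OF idempotent_in G]]
    by (intro sum.cong refl) (simp add: mult_ac)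
  also have "\<dots> = (\<Sum>g\<in>?G. 1 / of_nat (card ?G) * \<chi> (g\<inverse>) * (\<Sum>f\<in>?D. ?m f * exterior_character (f O g)))"
    unfolding sum_distrib_left by (rule sum.swap)
  also have "\<dots> = (\<Sum>g\<in>?G. 1 / of_nat (card ?G) * \<chi> (g\<inverse>) * (if rk e = p then sgn_at e g else 0))"
    using moebius_sum_exterior_character[OF e, where 'a = 'a] by (intro sum.cong refl) simp
  also have "\<dots> = (if rk e = p then 1 / of_nat (card ?G) * (\<Sum>g\<in>?G. \<chi> (g\<inverse>) * sgn_at e g) else 0)"
    by (simp add: sum_distrib_left mult.assoc)
  also have "(\<Sum>g\<in>?G. \<chi> (g\<inverse>) * sgn_at e g)
      = (if \<forall>g\<in>?G. \<chi> g = sgn_at e g then of_nat (card ?G) else 0)"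
    by (rule linear_character_orthogonality[OF e \<chi>])
      (use sgn_at_mult[OF e] sgn_at_self[OF e] in auto)
  also have "of_nat (card ?G) \<noteq> (0 :: 'a)" using maximal_subgroup(1,8)[OF e] by auto
  then have "(if rk e = p then 1 / of_nat (card ?G) *
        (if \<forall>g\<in>?G. \<chi> g = sgn_at e g then of_nat (card ?G) else 0) else 0)
      = (if rk e = p \<and> (\<forall>g\<in>?G. \<chi> g = sgn_at e g) then 1 else 0 :: 'a)" by simp
  finally show ?thesis .
qed

text \<open>
  If the character is irreducible, each rank \<open>p\<close> idempotent \<open>e\<close> acts through \<open>\<epsilon>\<^sub>e\<close> with trace
  \<open>\<Sum>f\<le>e. \<mu>(f, e) \<theta>(f)\<close>, which is the sign of the identity \<open>e\<close>, hence nonzero; this forces the idempotents to be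
  isomorphic.
\<close>

lemma exterior_character_irreducible_iff:
  fixes \<rho> :: "pperm \<Rightarrow> 'a::field_char_0 mat"
  assumes \<rho>: "exterior_power_rep S n (rook_mat n) p d \<rho>"
  shows "character \<rho> \<in> Irr S \<longleftrightarrow>
    (\<forall>e\<in>idempotents S. \<forall>f\<in>idempotents S. rk e = p \<and> rk f = p \<longrightarrow> isomorphic_idempotents S e f)"
proof
  assume irr: "character \<rho> \<in> Irr S"
  have sum: "(\<Sum>f\<in>{f \<in> idempotents S. f \<subseteq> e}. of_int (moebius (idempotents S) f e) * character \<rho> f) = 1"
    if e: "e \<in> idempotents S" "rk e = p" for e
  proof -
    have "character \<rho> f = exterior_character (f O e)" if f: "f \<in> idempotents S" "f \<subseteq> e" for f
    proof -
      have "f O e = f" using idempotents_inter(1)[OF f(1) e(1)] f(2) by auto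
      then show ?thesis using character_rook_exterior_power[OF \<rho> idempotent_in[OF f(1)]] by simp
    qed
    then have "(\<Sum>f\<in>{f \<in> idempotents S. f \<subseteq> e}. of_int (moebius (idempotents S) f e) * character \<rho> f)
        = (\<Sum>f\<in>{f \<in> idempotents S. f \<subseteq> e}.
            of_int (moebius (idempotents S) f e) * exterior_character (f O e))"
      by (intro sum.cong refl) simp
    moreover have "sgn_at e e = (1 :: 'a)" by (rule sgn_at_self[OF e(1)])
    ultimately show ?thesis
      using moebius_sum_exterior_character[OF e(1) maximal_subgroup(1)[OF e(1)], where 'a = 'a] e(2)
      by simp
  qed
  show "\<forall>e\<in>idempotents S. \<forall>f\<in>idempotents S. rk e = p \<and> rk f = p \<longrightarrow> isomorphic_idempotents S e f"
    using isomorphic_if_irreducible[OF irr] sum by simp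
next
  assume "\<forall>e\<in>idempotents S. \<forall>f\<in>idempotents S. rk e = p \<and> rk f = p \<longrightarrow> isomorphic_idempotents S e f"
  then have "irreducible_rep S d \<rho>" by (intro exterior_power_irreducible[OF \<rho>]) blast
  then show "character \<rho> \<in> Irr S" unfolding Irr_def by blast
qed

end

theorem theorem6p6:
  fixes n p d :: nat
    and S :: "pperm set"
    and \<rho> :: "pperm \<Rightarrow> 'a::{alg_closed_field, field_char_0} mat"
  assumes "inverse_subsemigroup n S"
    and "p \<le> n"
    and "{e \<in> idempotents (partial_perms n). rk e = p} \<subseteq> S"
    and "exterior_power_rep S n (rook_mat n) p d \<rho>"
  shows "(\<forall>e\<in>idempotents S. \<forall>\<chi>\<in>Irr (maximal_subgroup S e).
            char_prod S e \<chi> (character \<rho>) =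
              (if rk e = p \<and> (\<forall>g\<in>maximal_subgroup S e. \<chi> g = sgn_at e g) then 1 else 0)) \<and>
         (character \<rho> \<in> Irr S \<longleftrightarrow>
            (\<forall>e\<in>idempotents S. \<forall>f\<in>idempotents S.
               rk e = p \<and> rk f = p \<longrightarrow> isomorphic_idempotents S e f)) \<and>
         (\<forall>q d' (\<rho>' :: pperm \<Rightarrow> 'a mat).
            q \<le> n \<and> exterior_power_rep (partial_perms n) n (rook_mat n) q d' \<rho>' \<longrightarrow>
            irreducible_rep (partial_perms n) d' \<rho>')"
proof -
  interpret contains_rank n S p
    using assms(1-3) by unfold_locales
  have "irreducible_rep (partial_perms n) d' \<rho>'"
    if "q \<le> n" "exterior_power_rep (partial_perms n) n (rook_mat n) q d' \<rho>'"
    for q d' and \<rho>' :: "pperm \<Rightarrow> 'a mat"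
    using contains_rank.exterior_power_irreducible[OF partial_perms_contains_rank[OF that(1)] that(2)]
      partial_perms_isomorphic by metis
  then show ?thesis
    using char_prod_exterior_power[OF assms(4)] exterior_character_irreducible_iff[OF assms(4)] by blast
qed

end
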